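(* Let $f\in\mathcal C^1(E)$ be $L$-Lipschitz smooth, let $g:E\to\overline{\mathbb R}$ be proper, lsc and prox-bounded with threshold $\gamma_g$, let $F=f+g$ with $F_\star=\inf F>-\infty$, and let the reference function $\phi$ satisfy the standing assumptions listed in the context, with $D=\sup_{x\in\operatorname{dom}\phi}\|x\|<\infty$. Assume that the stochastic gradient oracle satisfies $\mathbb E_\xi[\nabla f(x,\xi)]=\nabla f(x)$ and $\mathbb E_\xi[\|\nabla f(x,\xi)-\nabla f(x)\|^2]\le\sigma^2$ for all $x\in E$, for some $\sigma\ge0$, and that $f(\cdot,\xi)$ is $L$-Lipschitz smooth with probability $1$. Let $\alpha_k=(k+1)^{-2/3}$ and $\gamma_k=(k+1)^{-2/3}$, assume $\gamma_g>\gamma_k/\mu$ for all $k\in\mathbb N_0$, and let $x^0\in\operatorname{dom}g$. Let $\{x^k\}_{k\in\mathbb N_0}$ be generated by $$y^k=x^k-\gamma_k\nabla\phi^*(d^k),\qquad x^{k+1}\in\operatorname*{arg\,min}_{x\in E}\; g(x)+(\gamma_k\star\phi)(x-y^k),$$ with $d^0=\nabla f(x^0,\xi^0)$ and, for $k\ge1$, $$d^k=(1-\alpha_k)d^{k-1}+\alpha_k\nabla f(x^k,\xi^k)+(1-\alpha_k)\big(\nabla f(x^k,\xi^k)-\nabla f(x^{k-1},\xi^k)\big).$$ Then $$\frac1{K+1}\sum_{k=0}^K\mathbb E[\operatorname{gap}(x^{k+1})]\le\widetilde O\left((K+1)^{-1/3}\right),$$ where $\widetilde O$ hides logarithmic factors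 in $K$ and a constant independent of $K$.
   Context: $E$ is a Euclidean space with inner product $\langle\cdot,\cdot\rangle$ and induced norm $\|\cdot\|$; $\overline{\mathbb R}=\mathbb R\cup\{\pm\infty\}$. Standing assumptions on the reference function $\phi:E\to\overline{\mathbb R}$: $\phi$ is lsc, $\mu$-strongly convex ($\mu>0$) and even, $\phi\ge0$, $\phi(0)=0$; $\operatorname{int}\operatorname{dom}\phi\ne\emptyset$; $\phi\in\mathcal C^1(\operatorname{int}\operatorname{dom}\phi)$; and $\|\nabla\phi(x^k)\|\to+\infty$ for any sequence $\{x^k\}$ in $\operatorname{int}\operatorname{dom}\phi$ converging to a boundary point of $\operatorname{dom}\phi$. $\phi^*(y)=\sup_{x\in E}\langle y,x\rangle-\phi(x)$ is the convex conjugate (finite and differentiable on $E$). For $\gamma>0$, $(\gamma\star\phi)(x)=\gamma\phi(\gamma^{-1}x)$. The Bregman divergence is $D_{\phi^*}(y,\bar y)=\phi^*(y)-\phi^*(\bar y)-\langle\nabla\phi^*(\bar y),y-\bar y\rangle$. A function is $L$-Lipschitz smooth ($L>0$) if it is continuously differentiable with $L$-Lipschitz gradient on $E$. A function $g:E\to\overline{\mathbb R}$ is prox-bounded if there is $\lambda>0$ with $\inf_{x\in E}g(x)+\frac1{2\lambda}\|x-\bar x\|^2>-\infty$ for some $\bar x\in E$; the supremum of all such $\lambda$ is the threshold $\gamma_g$. $\partial g$ is the limiting (Mordukhovich) subdifferential. Subgradient chosen by the algorithm: $\widetilde\nabla g(x^{k+1})\in\partial g(x^{k+1})$ is the subgradient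 given by the optimality condition of the backward step, i.e. $\widetilde\nabla g(x^{k+1})=-\nabla\phi(\frac1{\gamma_k}(x^{k+1}-y^k))$, equivalently $x^{k+1}-x^k=-\gamma_k\nabla\phi^*(d^k)-\gamma_k\nabla\phi^*(\widetilde\nabla g(x^{k+1}))$. The stationarity measure is $\operatorname{gap}(x^{k+1})=D_{\phi^*}(\nabla f(x^{k+1}),-\widetilde\nabla g(x^{k+1}))$. The samples $\xi^0,\xi^1,\dots$ are independent copies of the random variable $\xi$, $\xi^k$ being drawn at iteration $k$ independently of the past. $\mathbb E$ denotes total expectation. The bound $a_K\le\widetilde O((K+1)^{-1/3})$ means that there are constants $C,q\ge0$ independent of $K$ with $a_K\le C(1+\ln(K+1))^q(K+1)^{-1/3}$. *)

theory Defs
  imports "HOL-Probability.Probability"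
begin

(* Meaningful only where h is differentiable (Frechet sense); arbitrary elsewhere. *)
definition grad :: "('a::euclidean_space \<Rightarrow> real) \<Rightarrow> 'a \<Rightarrow> 'a" where
  "grad h x = (THE v. GDERIV h x :> v)"

definition C1_on :: "'a::euclidean_space set \<Rightarrow> ('a \<Rightarrow> real) \<Rightarrow> bool" where
  "C1_on U h \<longleftrightarrow> (\<forall>x\<in>U. GDERIV h x :> grad h x) \<and> continuous_on U (grad h)"

definition lipschitz_smooth :: "real \<Rightarrow> ('a::euclidean_space \<Rightarrow> real) \<Rightarrow> bool" where
  "lipschitz_smooth L h \<longleftrightarrow> C1_on UNIV h \<and> L-lipschitz_on UNIV (grad h)"

definition edom :: "('a \<Rightarrow> ereal) \<Rightarrow> 'a set" where
  "edom h = {x. h x < \<infinity>}"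

definition proper :: "('a \<Rightarrow> ereal) \<Rightarrow> bool" where
  "proper h \<longleftrightarrow> (\<forall>x. h x \<noteq> - \<infinity>) \<and> edom h \<noteq> {}"

definition lsc :: "('a::topological_space \<Rightarrow> ereal) \<Rightarrow> bool" where
  "lsc h \<longleftrightarrow> (\<forall>x. h x \<le> Liminf (at x) h)"

definition strongly_convex :: "real \<Rightarrow> ('a::real_inner \<Rightarrow> ereal) \<Rightarrow> bool" where
  "strongly_convex \<mu> h \<longleftrightarrow> \<mu> > 0 \<and>
     (\<forall>x y. \<forall>t\<in>{0..1}. h ((1 - t) *\<^sub>R x + t *\<^sub>R y)
        \<le> ereal (1 - t) * h x + ereal t * h y - ereal (\<mu> / 2 * t * (1 - t) * (norm (x - y))\<^sup>2))"

abbreviation finite_part :: "('a \<Rightarrow> ereal) \<Rightarrow> 'a \<Rightarrow> real" where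
  "finite_part h \<equiv> \<lambda>x. real_of_ereal (h x)"

definition reference_function :: "real \<Rightarrow> ('a::euclidean_space \<Rightarrow> ereal) \<Rightarrow> bool" where
  "reference_function \<mu> \<phi> \<longleftrightarrow>
     lsc \<phi> \<and> strongly_convex \<mu> \<phi> \<and> (\<forall>x. \<phi> (- x) = \<phi> x) \<and> (\<forall>x. \<phi> x \<ge> 0) \<and> \<phi> 0 = 0 \<and>
     interior (edom \<phi>) \<noteq> {} \<and> C1_on (interior (edom \<phi>)) (finite_part \<phi>) \<and>
     (\<forall>u z. (\<forall>k. u k \<in> interior (edom \<phi>)) \<and> u \<longlonglongrightarrow> z \<and> z \<in> frontier (edom \<phi>) \<longrightarrow>
        filterlim (\<lambda>k. norm (grad (finite_part \<phi>) (u k))) at_top sequentially)"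

definition conjugate :: "('a::real_inner \<Rightarrow> ereal) \<Rightarrow> 'a \<Rightarrow> ereal" where
  "conjugate \<phi> y = (SUP x. ereal (inner y x) - \<phi> x)"

definition epi_scale :: "real \<Rightarrow> ('a::real_vector \<Rightarrow> ereal) \<Rightarrow> 'a \<Rightarrow> ereal" where
  "epi_scale \<gamma> \<phi> x = ereal \<gamma> * \<phi> (inverse \<gamma> *\<^sub>R x)"

definition bregman :: "('a::euclidean_space \<Rightarrow> real) \<Rightarrow> 'a \<Rightarrow> 'a \<Rightarrow> real" where
  "bregman h y z = h y - h z - inner (grad h z) (y - z)"

definition prox_parameters :: "('a::real_normed_vector \<Rightarrow> ereal) \<Rightarrow> real set" where
  "prox_parameters g = {l. l > 0 \<and>
     (\<exists>z. (INF x. g x + ereal (1 / (2 * l) * (norm (x - z))\<^sup>2)) > - \<infinity>)}"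

definition prox_bounded :: "('a::real_normed_vector \<Rightarrow> ereal) \<Rightarrow> bool" where
  "prox_bounded g \<longleftrightarrow> prox_parameters g \<noteq> {}"

definition prox_threshold :: "('a::real_normed_vector \<Rightarrow> ereal) \<Rightarrow> ereal" where
  "prox_threshold g = (SUP l\<in>prox_parameters g. ereal l)"

definition regular_subdifferential :: "('a::euclidean_space \<Rightarrow> ereal) \<Rightarrow> 'a \<Rightarrow> 'a set" where
  "regular_subdifferential g x = {v. \<bar>g x\<bar> \<noteq> \<infinity> \<and>
     Liminf (at x) (\<lambda>z. (g z - g x - ereal (inner v (z - x))) / ereal (norm (z - x))) \<ge> 0}"

definition limiting_subdifferential :: "('a::euclidean_space \<Rightarrow> ereal) \<Rightarrow> 'a \<Rightarrow> 'a set" where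
  "limiting_subdifferential g x = {v. \<bar>g x\<bar> \<noteq> \<infinity> \<and>
     (\<exists>u w. u \<longlonglongrightarrow> x \<and> (\<lambda>n. g (u n)) \<longlonglongrightarrow> g x \<and>
        (\<forall>n. w n \<in> regular_subdifferential g (u n)) \<and> w \<longlonglongrightarrow> v)}"

(* v is the subgradient of g at x' given by the optimality condition of the backward step
   from y with stepsize \<gamma>. Writing grad \<phi> at (x' - y) / \<gamma> presupposes that this point lies in
   int dom \<phi>; it is the range of the gradient of the conjugate, so the condition is
   implicit in the equivalent form (x' - y) / \<gamma> = - grad \<phi>* v as well. *)
definition backward_subgradient ::
    "('a::euclidean_space \<Rightarrow> ereal) \<Rightarrow> ('a \<Rightarrow> ereal) \<Rightarrow> real \<Rightarrow> 'a \<Rightarrow> 'a \<Rightarrow> 'a \<Rightarrow> bool" where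
  "backward_subgradient \<phi> g \<gamma> y x' v \<longleftrightarrow>
     v \<in> limiting_subdifferential g x' \<and>
     inverse \<gamma> *\<^sub>R (x' - y) \<in> interior (edom \<phi>) \<and>
     v = - grad (finite_part \<phi>) (inverse \<gamma> *\<^sub>R (x' - y))"

(* The events known before sample k is drawn: the sigma-algebra on the space of M generated by
   the samples 0..k-1 and the iterates 0..k. The iterates have to be included, since a
   non-unique minimizer may be selected at random. *)
definition past :: "'w measure \<Rightarrow> 's measure \<Rightarrow> (nat \<Rightarrow> 'w \<Rightarrow> 's) \<Rightarrow>
    (nat \<Rightarrow> 'w \<Rightarrow> 'a::euclidean_space) \<Rightarrow> nat \<Rightarrow> 'w set set" where
  "past M P \<xi> x k = sets (vimage_algebra (space M)
     (\<lambda>\<omega>. (\<lambda>i\<in>{..<k}. \<xi> i \<omega>, \<lambda>i\<in>{..k}. x i \<omega>))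
     (PiM {..<k} (\<lambda>_. P) \<Otimes>\<^sub>M PiM {..k} (\<lambda>_. borel)))"

end

theory Submission
  imports Defs
begin

text \<open>
  Why the rate holds. Strong convexity and the bounded domain of \<open>\<phi>\<close> make \<open>\<phi>\<^sup>*\<close> finite and
  \<open>1/\<mu>\<close>-smooth with gradient bounded by \<open>D\<close>. Since the forward and the backward displacement are
  \<open>\<gamma>\<^sub>k\<close> times gradients of \<open>\<phi>\<^sup>*\<close>, every step has length at most \<open>2 D \<gamma>\<^sub>k\<close>, whatever the noise.
  Fenchel duality then rewrites the decrease in the backward step (\<open>forward_backward_step\<close>) as
  \<open>\<gamma>\<^sub>k gap(x\<^sup>k\<^sup>+\<^sup>1) \<le> F(x\<^sup>k) - F(x\<^sup>k\<^sup>+\<^sup>1) + \<gamma>\<^sub>k \<parallel>d\<^sup>k - \<nabla>f(x\<^sup>k)\<parallel>\<^sup>2 / (2 \<mu>) + 8 L D\<^sup>2 \<gamma>\<^sub>k\<^sup>2\<close>.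

  It remains to control the error of the estimator. Up to centred noise of the fresh sample, the
  error is multiplied by \<open>1 - \<alpha>\<^sub>k\<close> in each step. The noise has variance of order \<open>\<alpha>\<^sub>k\<^sup>2\<close>: the plain oracle
  noise enters with the weight \<open>\<alpha>\<^sub>k\<close>, and the correction term is a difference of gradients at two
  points at distance of order \<open>\<gamma>\<^sub>k = \<alpha>\<^sub>k\<close>. The recursion
  \<open>E\<^sub>k \<le> (1 - \<alpha>\<^sub>k) E\<^sub>k\<^sub>-\<^sub>1 + C \<alpha>\<^sub>k\<^sup>2\<close> with \<open>\<alpha>\<^sub>k = (k+1) powr (-2/3)\<close> yields \<open>E\<^sub>k \<le> 3 C \<alpha>\<^sub>k\<close>
  (\<open>error_second_moment\<close>).

  Therefore the right-hand sides sum, in expectation, to a constant plus a multiple of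
  \<open>\<Sum>k. (k+1) powr (-4/3)\<close>, which converges. As the gaps are nonnegative, the weights \<open>\<gamma>\<^sub>k\<close>
  may be replaced by the smallest one, \<open>\<gamma>\<^sub>K = (K+1) powr (-2/3)\<close>, and dividing by \<open>(K+1) \<gamma>\<^sub>K\<close> gives the
  rate \<open>(K+1) powr (-1/3)\<close>. No logarithm is lost, so the exponent \<open>q = 0\<close> suffices.
\<close>

section \<open>Gradients and Lipschitz smoothness\<close>

lemma grad_eqI:
  fixes h :: "'a::euclidean_space \<Rightarrow> real"
  assumes "GDERIV h x :> v"
  shows "grad h x = v"
  unfolding grad_def
proof (rule the_equality, rule assms)
  fix w assume "GDERIV h x :> w"
  with assms have "(\<lambda>k. inner k v) = (\<lambda>k. inner k w)"
    unfolding gderiv_def by (rule has_derivative_unique)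
  then have "\<And>k. inner k v = inner k w" by metis
  then show "w = v" by (metis inner_commute vector_eq_ldot)
qed

lemma lipschitz_smooth_GDERIV:
  "lipschitz_smooth L f \<Longrightarrow> GDERIV f x :> grad f x"
  by (simp add: lipschitz_smooth_def C1_on_def)

lemma lipschitz_smooth_grad_norm_diff_le:
  "lipschitz_smooth L f \<Longrightarrow> norm (grad f x - grad f y) \<le> L * norm (x - y)"
  unfolding lipschitz_smooth_def by (metis UNIV_I dist_norm lipschitz_onD)

lemma lipschitz_smooth_continuous_grad:
  "lipschitz_smooth L f \<Longrightarrow> continuous_on UNIV (grad f)"
  by (simp add: lipschitz_smooth_def C1_on_def)

text \<open>The mean value theorem along the segment; it loses a factor \<open>2\<close> against the optimal
constant \<open>L / 2\<close>, which is irrelevant for a rate.\<close>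
lemma lipschitz_smooth_upper_bound:
  fixes f :: "'a::euclidean_space \<Rightarrow> real"
  assumes "lipschitz_smooth L f"
  shows "f z \<le> f x + inner (grad f x) (z - x) + L * (norm (z - x))\<^sup>2"
proof -
  define c where "c t = x + t *\<^sub>R (z - x)" for t :: real
  have L: "L \<ge> 0" using assms by (auto simp: lipschitz_smooth_def lipschitz_on_def)
  have der: "((\<lambda>t. f (c t)) has_real_derivative inner (grad f (c t)) (z - x)) (at t)" for t
  proof -
    have "(c has_derivative (\<lambda>s. s *\<^sub>R (z - x))) (at t)"
      unfolding c_def by (auto intro!: derivative_eq_intros)
    moreover have "(f has_derivative (\<lambda>k. inner k (grad f (c t)))) (at (c t))"
      using lipschitz_smooth_GDERIV[OF assms] by (simp add: gderiv_def)
    ultimately have "((\<lambda>t. f (c t)) has_derivative (\<lambda>s. inner (s *\<^sub>R (z - x)) (grad f (c t)))) (at t)"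
      by (rule has_derivative_compose)
    then show ?thesis
      by (simp add: has_field_derivative_def inner_commute mult.commute[of _ "inner _ _"])
  qed
  obtain t where t: "0 < t" "t < 1" "f (c 1) - f (c 0) = (1 - 0) * inner (grad f (c t)) (z - x)"
    using MVT2[of 0 1 "\<lambda>t. f (c t)" "\<lambda>t. inner (grad f (c t)) (z - x)"] der by auto
  have "norm (c t - x) \<le> norm (z - x)"
    using t by (simp add: c_def mult_left_le_one_le)
  then have "norm (grad f (c t) - grad f x) \<le> L * norm (z - x)"
    using lipschitz_smooth_grad_norm_diff_le[OF assms, of "c t" x] L
    by (meson mult_left_mono order_trans)
  then have "inner (grad f (c t) - grad f x) (z - x) \<le> L * norm (z - x) * norm (z - x)"
    by (meson norm_cauchy_schwarz mult_right_mono norm_ge_zero order_trans)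
  then show ?thesis using t by (simp add: c_def inner_diff_left power2_eq_square)
qed

section \<open>The conjugate of a reference function with bounded domain\<close>

locale bounded_reference =
  fixes \<mu> D :: real and \<phi> :: "'a::euclidean_space \<Rightarrow> ereal"
  assumes reference: "reference_function \<mu> \<phi>"
    and domain_bound: "\<And>z. z \<in> edom \<phi> \<Longrightarrow> norm z \<le> D"
begin

text \<open>The real-valued versions of \<open>\<phi>\<close> and \<open>\<phi>\<^sup>*\<close> are kept opaque, because
\<open>\<phi> x = ereal (\<phi>r x)\<close> with \<open>\<phi>r\<close> unfolded would rewrite \<open>\<phi> x\<close> to a term that contains
\<open>\<phi> x\<close> again.\<close>
definition \<phi>r :: "'a \<Rightarrow> real" where "\<phi>r = finite_part \<phi>"
definition h :: "'a \<Rightarrow> real" where "h = finite_part (conjugate \<phi>)"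

lemma reference_nonneg: "\<phi> x \<ge> 0" and reference_zero: "\<phi> 0 = 0" and mu_pos: "\<mu> > 0"
  using reference by (auto simp: reference_function_def strongly_convex_def)

lemma D_nonneg: "D \<ge> 0"
  using domain_bound[of 0] by (simp add: edom_def reference_zero)

lemma finite_on_domain: "x \<in> edom \<phi> \<Longrightarrow> \<phi> x = ereal (\<phi>r x)"
  using reference_nonneg[of x] by (cases "\<phi> x") (auto simp: edom_def \<phi>r_def)

lemma \<phi>r_nonneg: "\<phi>r x \<ge> 0"
  using reference_nonneg[of x] by (cases "\<phi> x") (auto simp: \<phi>r_def)

lemma strongly_convex_on_domain:
  assumes "x \<in> edom \<phi>" "z \<in> edom \<phi>" "0 \<le> t" "t \<le> 1"
  shows "(1 - t) *\<^sub>R x + t *\<^sub>R z \<in> edom \<phi>"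
    and "\<phi>r ((1 - t) *\<^sub>R x + t *\<^sub>R z)
      \<le> (1 - t) * \<phi>r x + t * \<phi>r z - \<mu> / 2 * t * (1 - t) * (norm (x - z))\<^sup>2"
proof -
  let ?w = "(1 - t) *\<^sub>R x + t *\<^sub>R z"
  have "\<phi> ?w \<le> ereal (1 - t) * \<phi> x + ereal t * \<phi> z - ereal (\<mu> / 2 * t * (1 - t) * (norm (x - z))\<^sup>2)"
    using reference assms by (auto simp: reference_function_def strongly_convex_def)
  then have *: "\<phi> ?w \<le> ereal ((1 - t) * \<phi>r x + t * \<phi>r z - \<mu> / 2 * t * (1 - t) * (norm (x - z))\<^sup>2)"
    by (simp add: finite_on_domain[OF assms(1)] finite_on_domain[OF assms(2)])
  show w: "?w \<in> edom \<phi>"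
    unfolding edom_def using * by (auto intro: le_less_trans)
  show "\<phi>r ?w \<le> (1 - t) * \<phi>r x + t * \<phi>r z - \<mu> / 2 * t * (1 - t) * (norm (x - z))\<^sup>2"
    using * finite_on_domain[OF w] by simp
qed

lemma conjugate_bounds: "0 \<le> conjugate \<phi> y" "conjugate \<phi> y \<le> ereal (norm y * D)"
proof -
  have "ereal (inner y 0) - \<phi> 0 \<le> conjugate \<phi> y"
    unfolding conjugate_def by (rule SUP_upper) simp
  then show "0 \<le> conjugate \<phi> y" by (simp add: reference_zero zero_ereal_def[symmetric])
  show "conjugate \<phi> y \<le> ereal (norm y * D)"
    unfolding conjugate_def
  proof (rule SUP_least)
    fix x show "ereal (inner y x) - \<phi> x \<le> ereal (norm y * D)"
    proof (cases "x \<in> edom \<phi>")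
      case True
      have "inner y x \<le> norm y * norm x" by (rule norm_cauchy_schwarz)
      also have "\<dots> \<le> norm y * D" by (simp add: domain_bound[OF True] mult_left_mono)
      finally have "inner y x - \<phi>r x \<le> norm y * D" using \<phi>r_nonneg[of x] by linarith
      then show ?thesis by (simp add: finite_on_domain[OF True])
    qed (auto simp: edom_def)
  qed
qed

lemma conjugate_finite: "conjugate \<phi> y = ereal (h y)"
  using conjugate_bounds[of y] by (cases "conjugate \<phi> y") (auto simp: h_def)

lemma fenchel_young: "x \<in> edom \<phi> \<Longrightarrow> inner y x - \<phi>r x \<le> h y"
proof -
  assume x: "x \<in> edom \<phi>"
  have "ereal (inner y x) - \<phi> x \<le> conjugate \<phi> y"
    unfolding conjugate_def by (rule SUP_upper) simp
  then show ?thesis by (simp add: conjugate_finite finite_on_domain[OF x])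
qed

text \<open>Equality in the Fenchel--Young inequality: \<open>y \<in> \<partial>\<phi> p\<close>, or equivalently \<open>p\<close> attains the
supremum that defines \<open>\<phi>\<^sup>* y\<close>. All properties of \<open>\<phi>\<^sup>*\<close> below come from such pairs.\<close>
definition dual_pair :: "'a \<Rightarrow> 'a \<Rightarrow> bool" where
  "dual_pair y p \<longleftrightarrow> p \<in> edom \<phi> \<and> h y = inner y p - \<phi>r p"

text \<open>The supremum is attained: a maximizing sequence stays in the bounded domain, so a subsequence
converges, and lower semicontinuity bounds \<open>\<phi>\<close> at the limit.\<close>
lemma ex_dual_pair: "\<exists>p. dual_pair y p"
proof -
  have "\<exists>x. x \<in> edom \<phi> \<and> h y - 1 / real (Suc n) < inner y x - \<phi>r x" for n
  proof -
    have "ereal (h y - 1 / real (Suc n)) < conjugate \<phi> y"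
      by (simp add: conjugate_finite)
    then obtain x where x: "ereal (h y - 1 / real (Suc n)) < ereal (inner y x) - \<phi> x"
      unfolding conjugate_def less_SUP_iff by auto
    then have "x \<in> edom \<phi>" by (auto simp: edom_def)
    with x show ?thesis by (auto simp: finite_on_domain)
  qed
  then obtain X where X: "\<And>n. X n \<in> edom \<phi>"
    "\<And>n. h y - 1 / real (Suc n) < inner y (X n) - \<phi>r (X n)" by metis
  have "bounded (range X)"
    using X(1) domain_bound by (auto simp: bounded_iff)
  then obtain p r where r: "strict_mono r" and lim: "(X \<circ> r) \<longlonglongrightarrow> p"
    using bounded_imp_convergent_subsequence by blast
  have lsc: "\<phi> p \<le> Liminf (at p) \<phi>"
    using reference by (auto simp: reference_function_def lsc_def)
  have le: "\<phi> p \<le> ereal (inner y p - h y)"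
  proof (rule ccontr)
    assume "\<not> ?thesis"
    then have "ereal (inner y p - h y) < \<phi> p" by simp
    then obtain c where c: "inner y p - h y < c" "ereal c < \<phi> p"
      by (metis ereal_dense2 ereal_less_eq(3) not_less)
    \<comment> \<open>The punctured limit inferior ignores the value at the point itself; here \<open>c < \<phi> p\<close>
    supplies it.\<close>
    have "eventually (\<lambda>x. ereal c < \<phi> x) (at p)"
      using lsc c(2) by (metis le_Liminf_iff)
    then have "eventually (\<lambda>x. ereal c < \<phi> x) (nhds p)"
      using c(2) by (auto simp: eventually_at_filter elim: eventually_mono)
    then have ev: "eventually (\<lambda>n. ereal c < \<phi> ((X \<circ> r) n)) sequentially"
      using lim by (auto simp: filterlim_iff)
    have "eventually (\<lambda>n. c \<le> inner y ((X \<circ> r) n) - h y + inverse (real (Suc (r n)))) sequentially"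
      using ev
    proof eventually_elim
      case (elim n)
      then have "c < \<phi>r (X (r n))" using finite_on_domain[OF X(1)[of "r n"]] by simp
      then show ?case using X(2)[of "r n"] by (simp add: inverse_eq_divide)
    qed
    moreover have "(\<lambda>n. inverse (real (Suc (r n)))) \<longlonglongrightarrow> 0"
      using LIMSEQ_subseq_LIMSEQ[OF LIMSEQ_inverse_real_of_nat r] by (simp add: o_def)
    then have "(\<lambda>n. inner y ((X \<circ> r) n) - h y + inverse (real (Suc (r n)))) \<longlonglongrightarrow> inner y p - h y + 0"
      by (intro tendsto_intros lim)
    ultimately have "c \<le> inner y p - h y + 0"
      by (intro tendsto_lowerbound) auto
    with c show False by simp
  qed
  then have p: "p \<in> edom \<phi>" by (auto simp: edom_def intro: le_less_trans)
  with le have "h y \<le> inner y p - \<phi>r p" by (simp add: finite_on_domain)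
  with fenchel_young[OF p, of y] p show ?thesis by (auto simp: dual_pair_def)
qed

text \<open>On the segment from \<open>p\<close> to \<open>x\<close>, strong convexity bounds \<open>\<phi>\<close> from above and the
Fenchel--Young inequality from below; dividing by the segment parameter \<open>t\<close> and letting
\<open>t\<close> tend to \<open>0\<close> keeps the whole quadratic term.\<close>
lemma dual_pair_strong_subgradient:
  assumes "dual_pair y p" "x \<in> edom \<phi>"
  shows "\<phi>r p + inner y (x - p) + \<mu> / 2 * (norm (x - p))\<^sup>2 \<le> \<phi>r x"
proof -
  define c where "c = \<mu> / 2 * (norm (x - p))\<^sup>2"
  have p: "p \<in> edom \<phi>" and hy: "h y = inner y p - \<phi>r p"
    using assms by (auto simp: dual_pair_def)
  have step: "inner y (x - p) + (1 - t) * c \<le> \<phi>r x - \<phi>r p" if t: "0 < t" "t < 1" for t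
  proof -
    let ?w = "(1 - t) *\<^sub>R p + t *\<^sub>R x"
    have "inner y ?w - (inner y p - \<phi>r p) \<le> \<phi>r ?w"
      using fenchel_young[OF strongly_convex_on_domain(1)[OF p assms(2)], of t y] t hy by simp
    also have "\<dots> \<le> (1 - t) * \<phi>r p + t * \<phi>r x - t * (1 - t) * c"
      using strongly_convex_on_domain(2)[OF p assms(2), of t] t
      by (simp add: c_def norm_minus_commute mult_ac)
    finally have "t * (inner y (x - p) + (1 - t) * c) \<le> t * (\<phi>r x - \<phi>r p)"
      by (simp add: algebra_simps inner_add_right inner_diff_right)
    with t show ?thesis by simp
  qed
  have "((\<lambda>t. inner y (x - p) + (1 - t) * c) \<longlongrightarrow> inner y (x - p) + (1 - 0) * c) (at_right 0)"
    by (intro tendsto_intros)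
  moreover have "eventually (\<lambda>t::real. inner y (x - p) + (1 - t) * c \<le> \<phi>r x - \<phi>r p) (at_right 0)"
    unfolding eventually_at_right_field by (intro exI[of _ 1]) (auto intro: step)
  ultimately have "inner y (x - p) + (1 - 0) * c \<le> \<phi>r x - \<phi>r p"
    by (intro tendsto_upperbound) auto
  then show ?thesis by (simp add: c_def)
qed

lemma conjugate_lower:
  assumes "dual_pair y p"
  shows "h y + inner p (z - y) \<le> h z"
  using fenchel_young[of p z] assms
  by (simp add: dual_pair_def inner_diff_right inner_commute)

text \<open>Strong convexity of \<open>\<phi>\<close> dualizes to smoothness of \<open>\<phi>\<^sup>*\<close>: evaluate \<open>\<phi>\<^sup>* z\<close> at its maximizer,
bound \<open>\<phi>\<close> there by the strong subgradient inequality at \<open>p\<close>, and complete the square.\<close>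
lemma conjugate_upper:
  assumes "dual_pair y p"
  shows "h z \<le> h y + inner p (z - y) + (norm (z - y))\<^sup>2 / (2 * \<mu>)"
proof -
  obtain x where x: "dual_pair z x" using ex_dual_pair by blast
  define a b where "a = norm (z - y)" and "b = norm (x - p)"
  have "0 \<le> (a - \<mu> * b)\<^sup>2 / (2 * \<mu>)" using mu_pos by simp
  also have "\<dots> = a\<^sup>2 / (2 * \<mu>) - a * b + \<mu> / 2 * b\<^sup>2"
    using mu_pos by (simp add: field_simps power2_eq_square)
  finally have "a * b - \<mu> / 2 * b\<^sup>2 \<le> a\<^sup>2 / (2 * \<mu>)" by simp
  moreover have "inner (z - y) (x - p) \<le> a * b"
    unfolding a_def b_def by (rule norm_cauchy_schwarz)
  moreover have "\<phi>r p + inner y (x - p) + \<mu> / 2 * b\<^sup>2 \<le> \<phi>r x"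
    unfolding b_def using x assms by (intro dual_pair_strong_subgradient) (auto simp: dual_pair_def)
  ultimately show ?thesis using x assms
    by (simp add: dual_pair_def a_def[symmetric] inner_diff_right inner_diff_left inner_commute algebra_simps)
qed

text \<open>The affine minorant and the quadratic majorant touch at \<open>y\<close>, so they squeeze the difference
quotient.\<close>
lemma conjugate_GDERIV:
  assumes "dual_pair y p"
  shows "GDERIV h y :> p"
  unfolding gderiv_def
proof (rule has_derivativeI_sandwich[of 1])
  show "bounded_linear (\<lambda>k. inner k p)" by (rule bounded_linear_inner_left)
  fix z assume "z \<noteq> y"
  have "\<bar>h z - h y - inner p (z - y)\<bar> \<le> (norm (z - y))\<^sup>2 / (2 * \<mu>)"
    using conjugate_lower[OF assms, of z] conjugate_upper[OF assms, of z] by linarith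
  with \<open>z \<noteq> y\<close> show "norm (h z - h y - inner (z - y) p) / norm (z - y) \<le> norm (z - y) / (2 * \<mu>)"
    using mu_pos by (simp add: divide_simps inner_commute power2_eq_square)
next
  have "((\<lambda>z. norm (z - y) / (2 * \<mu>)) \<longlongrightarrow> norm (y - y) / (2 * \<mu>)) (at y)"
    by (intro tendsto_intros) (use mu_pos in auto)
  then show "((\<lambda>z. norm (z - y) / (2 * \<mu>)) \<longlongrightarrow> 0) (at y)" by simp
qed simp

lemma grad_conjugate: "dual_pair y p \<Longrightarrow> grad h y = p"
  by (rule grad_eqI[OF conjugate_GDERIV])

lemma dual_pair_grad: "dual_pair y (grad h y)"
  using ex_dual_pair[of y] grad_conjugate by auto

lemma norm_grad_conjugate_le: "norm (grad h y) \<le> D"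
  using dual_pair_grad[of y] by (auto simp: dual_pair_def intro: domain_bound)

lemma continuous_conjugate: "continuous_on UNIV h"
  using conjugate_GDERIV[OF dual_pair_grad]
  by (intro continuous_at_imp_continuous_on ballI) (auto simp: gderiv_def intro: has_derivative_continuous)

lemma continuous_grad_conjugate: "continuous_on UNIV (grad h)"
proof (rule lipschitz_on_continuous_on)
  show "(1 / \<mu>)-lipschitz_on UNIV (grad h)"
  proof (rule lipschitz_onI)
    fix y z :: 'a
    let ?p = "grad h y" and ?q = "grad h z"
    have "\<phi>r ?p + inner y (?q - ?p) + \<mu> / 2 * (norm (?q - ?p))\<^sup>2 \<le> \<phi>r ?q"
      "\<phi>r ?q + inner z (?p - ?q) + \<mu> / 2 * (norm (?p - ?q))\<^sup>2 \<le> \<phi>r ?p"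
      using dual_pair_strong_subgradient dual_pair_grad dual_pair_def by blast+
    then have "\<mu> * (norm (?p - ?q))\<^sup>2 \<le> inner (y - z) (?p - ?q)"
      by (simp add: norm_minus_commute[of ?q] inner_diff_left inner_diff_right)
    also have "\<dots> \<le> norm (y - z) * norm (?p - ?q)" by (rule norm_cauchy_schwarz)
    finally have "\<mu> * norm (?p - ?q) \<le> norm (y - z)"
      by (cases "norm (?p - ?q) = 0") (auto simp: power2_eq_square)
    then show "dist ?p ?q \<le> 1 / \<mu> * dist y z"
      using mu_pos by (simp add: dist_norm field_simps)
  qed (use mu_pos in simp)
qed

text \<open>The inverse relation between \<open>\<nabla>\<phi>\<close> and \<open>\<nabla>\<phi>\<^sup>*\<close>. It turns the optimality condition of the backward
step, which is stated with \<open>\<nabla>\<phi>\<close>, into a formula for the displacement in terms of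
\<open>\<nabla>\<phi>\<^sup>*\<close>.\<close>
lemma dual_pair_interior:
  assumes r: "r \<in> interior (edom \<phi>)"
  shows "dual_pair (grad \<phi>r r) r"
proof -
  let ?u = "grad \<phi>r r"
  have rd: "r \<in> edom \<phi>" using r interior_subset by auto
  have der: "(\<phi>r has_derivative (\<lambda>k. inner k ?u)) (at r)"
    using reference r by (auto simp: reference_function_def C1_on_def gderiv_def \<phi>r_def)
  have sub: "\<phi>r r + inner ?u (x - r) \<le> \<phi>r x" if x: "x \<in> edom \<phi>" for x
  proof -
    define c where "c t = r + t *\<^sub>R (x - r)" for t :: real
    have "(c has_derivative (\<lambda>s. s *\<^sub>R (x - r))) (at 0)"
      unfolding c_def by (auto intro!: derivative_eq_intros)
    moreover have "(\<phi>r has_derivative (\<lambda>k. inner k ?u)) (at (c 0))" using der by (simp add: c_def)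
    ultimately have "((\<lambda>t. \<phi>r (c t)) has_derivative (\<lambda>s. inner (s *\<^sub>R (x - r)) ?u)) (at 0)"
      by (rule has_derivative_compose)
    then have "((\<lambda>t. \<phi>r (c t)) has_real_derivative inner ?u (x - r)) (at 0)"
      by (simp add: has_field_derivative_def inner_commute mult.commute[of _ "inner _ _"])
    then have "((\<lambda>t. (\<phi>r (c t) - \<phi>r (c 0)) / (t - 0)) \<longlongrightarrow> inner ?u (x - r)) (at 0)"
      by (simp add: has_field_derivative_iff)
    then have "((\<lambda>t. (\<phi>r (c t) - \<phi>r r) / t) \<longlongrightarrow> inner ?u (x - r)) (at_right 0)"
      by (simp add: c_def filterlim_at_split)
    moreover have "(\<phi>r (c t) - \<phi>r r) / t \<le> \<phi>r x - \<phi>r r" if t: "0 < t" "t < 1" for t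
    proof -
      have "c t = (1 - t) *\<^sub>R r + t *\<^sub>R x" by (simp add: c_def algebra_simps)
      then have "\<phi>r (c t) \<le> (1 - t) * \<phi>r r + t * \<phi>r x - \<mu> / 2 * t * (1 - t) * (norm (r - x))\<^sup>2"
        using strongly_convex_on_domain(2)[OF rd x, of t] t by simp
      moreover have "0 \<le> \<mu> / 2 * t * (1 - t) * (norm (r - x))\<^sup>2"
        using t mu_pos by simp
      ultimately show ?thesis using t by (simp add: field_simps)
    qed
    then have "eventually (\<lambda>t::real. (\<phi>r (c t) - \<phi>r r) / t \<le> \<phi>r x - \<phi>r r) (at_right 0)"
      unfolding eventually_at_right_field by (intro exI[of _ 1]) auto
    ultimately have "inner ?u (x - r) \<le> \<phi>r x - \<phi>r r"
      by (intro tendsto_upperbound) auto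
    then show ?thesis by simp
  qed
  obtain p where p: "dual_pair ?u p" using ex_dual_pair by blast
  then have "h ?u \<le> inner ?u r - \<phi>r r"
    using sub[of p] by (simp add: dual_pair_def inner_diff_right)
  with fenchel_young[OF rd, of ?u] rd show ?thesis by (auto simp: dual_pair_def)
qed

lemma bregman_nonneg: "0 \<le> bregman h z y"
  using conjugate_lower[OF dual_pair_grad, of y z] by (simp add: bregman_def)

lemma bregman_le: "bregman h z y \<le> (norm (z - y))\<^sup>2 / (2 * \<mu>)"
  using conjugate_upper[OF dual_pair_grad, of z y] by (simp add: bregman_def)

text \<open>The descent inequality controls the divergence at the gradient of the old iterate, whereas the
gap uses the new one. As \<open>\<nabla>\<phi>\<^sup>*\<close> takes values in the ball of radius \<open>D\<close>, exchanging them costs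
only a term linear in the distance.\<close>
lemma bregman_diff_le: "bregman h z y \<le> bregman h w y + 2 * D * norm (z - w)"
proof -
  have "h z + inner (grad h z) (w - z) \<le> h w" by (rule conjugate_lower[OF dual_pair_grad])
  then have "bregman h z y - bregman h w y \<le> inner (grad h z - grad h y) (z - w)"
    by (simp add: bregman_def inner_diff_left inner_diff_right)
  also have "\<dots> \<le> norm (grad h z - grad h y) * norm (z - w)" by (rule norm_cauchy_schwarz)
  also have "\<dots> \<le> (2 * D) * norm (z - w)"
    using norm_triangle_ineq4[of "grad h z" "grad h y"] norm_grad_conjugate_le[of z] norm_grad_conjugate_le[of y]
    by (intro mult_right_mono) auto
  finally show ?thesis by simp
qed

text \<open>Fenchel equality at \<open>a\<close> and at \<open>b\<close> trades the values of \<open>\<phi>\<close> for values of \<open>\<phi>\<^sup>*\<close>, and \<open>\<phi>\<^sup>* c\<close>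
cancels. With \<open>c\<close> the exact gradient, \<open>a\<close> its estimate and \<open>b\<close> the negated
backward subgradient, this produces the gap with a minus sign and the estimation error with a
plus sign.\<close>
lemma conjugate_exchange:
  "\<phi>r (grad h a) - \<phi>r (grad h b) - inner c (grad h a - grad h b) = bregman h c a - bregman h c b"
  using dual_pair_grad[of a] dual_pair_grad[of b]
  by (simp add: dual_pair_def bregman_def inner_diff_right inner_diff_left inner_commute)

text \<open>Comparing the backward minimizer with the point \<open>x\<close> bounds the change of \<open>g\<close>, and smoothness
bounds the change of \<open>f\<close>. Both the forward and the backward displacement are \<open>\<gamma>\<close> times a value
of \<open>\<nabla>\<phi>\<^sup>*\<close>, hence of length at most \<open>D \<gamma>\<close>; this makes all second-order terms deterministic
multiples of \<open>\<gamma>\<^sup>2\<close>. Half of the constant \<open>8 L D\<^sup>2\<close> comes from the smoothness bound and half from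
moving the gap from \<open>\<nabla>f x\<close> to \<open>\<nabla>f x'\<close>.\<close>
lemma forward_backward_step:
  fixes g :: "'a \<Rightarrow> ereal"
  assumes f: "lipschitz_smooth L f" and "\<gamma> > 0"
    and gx: "g x = ereal G" and gx': "g x' = ereal G'"
    and y: "y = x - \<gamma> *\<^sub>R grad h d"
    and argmin: "is_arg_min (\<lambda>z. g z + epi_scale \<gamma> \<phi> (z - y)) (\<lambda>_. True) x'"
    and bwd: "backward_subgradient \<phi> g \<gamma> y x' v"
  shows "grad h (- v) = inverse \<gamma> *\<^sub>R (x' - y)"
    and "norm (x' - x) \<le> 2 * D * \<gamma>"
    and "\<gamma> * bregman h (grad f x') (- v)
      \<le> (f x + G) - (f x' + G') + \<gamma> * ((norm (grad f x - d))\<^sup>2 / (2 * \<mu>)) + 8 * L * D\<^sup>2 * \<gamma>\<^sup>2"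
proof -
  let ?r = "inverse \<gamma> *\<^sub>R (x' - y)" and ?p = "grad h d"
  have int: "?r \<in> interior (edom \<phi>)" and v: "- v = grad \<phi>r ?r"
    using bwd by (auto simp: backward_subgradient_def \<phi>r_def)
  show r: "grad h (- v) = ?r"
    unfolding v by (rule grad_conjugate[OF dual_pair_interior[OF int]])
  have L: "L \<ge> 0" using f by (auto simp: lipschitz_smooth_def lipschitz_on_def)
  have "\<gamma> *\<^sub>R ?r = x' - y" using \<open>\<gamma> > 0\<close> by simp
  then have "x' - x = \<gamma> *\<^sub>R ?r - \<gamma> *\<^sub>R ?p" using y by simp
  then have diff: "x' - x = - \<gamma> *\<^sub>R (?p - ?r)" by (simp add: scaleR_diff_right)
  have "norm (?p - ?r) \<le> 2 * D"
    using norm_triangle_ineq4[of ?p ?r] norm_grad_conjugate_le[of d] norm_grad_conjugate_le[of "- v"]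
    unfolding r by linarith
  then show len: "norm (x' - x) \<le> 2 * D * \<gamma>"
    unfolding diff using \<open>\<gamma> > 0\<close> by (simp add: mult.commute)
  have p: "?p \<in> edom \<phi>" using dual_pair_grad[of d] by (simp add: dual_pair_def)
  have rd: "?r \<in> edom \<phi>" using int interior_subset by auto
  have "g x' + epi_scale \<gamma> \<phi> (x' - y) \<le> g x + epi_scale \<gamma> \<phi> (x - y)"
    using argmin by (simp add: is_arg_min_def not_less)
  moreover have "epi_scale \<gamma> \<phi> (x - y) = ereal (\<gamma> * \<phi>r ?p)"
    using \<open>\<gamma> > 0\<close> y by (simp add: epi_scale_def finite_on_domain[OF p])
  moreover have "epi_scale \<gamma> \<phi> (x' - y) = ereal (\<gamma> * \<phi>r ?r)"
    by (simp add: epi_scale_def finite_on_domain[OF rd])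
  ultimately have g_le: "G' + \<gamma> * \<phi>r ?r \<le> G + \<gamma> * \<phi>r ?p"
    by (simp add: gx gx')
  have f_le: "f x' \<le> f x + inner (grad f x) (x' - x) + L * (norm (x' - x))\<^sup>2"
    by (rule lipschitz_smooth_upper_bound[OF f])
  have sq: "L * (norm (x' - x))\<^sup>2 \<le> L * (2 * D * \<gamma>)\<^sup>2"
    using len L by (intro mult_left_mono power_mono) auto
  have ip: "inner (grad f x) (x' - x) = - \<gamma> * inner (grad f x) (?p - ?r)"
    unfolding diff by simp
  have "\<phi>r ?p - \<phi>r ?r - inner (grad f x) (?p - ?r) = bregman h (grad f x) d - bregman h (grad f x) (- v)"
    using conjugate_exchange[of d "- v" "grad f x"] r by simp
  then have ex: "\<gamma> * \<phi>r ?p - \<gamma> * \<phi>r ?r - \<gamma> * inner (grad f x) (?p - ?r)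
    = \<gamma> * bregman h (grad f x) d - \<gamma> * bregman h (grad f x) (- v)"
    by (metis right_diff_distrib)
  have "norm (grad f x' - grad f x) \<le> L * (2 * D * \<gamma>)"
    using lipschitz_smooth_grad_norm_diff_le[OF f, of x' x] mult_left_mono[OF len L] by linarith
  then have "2 * D * norm (grad f x' - grad f x) \<le> 2 * D * (L * (2 * D * \<gamma>))"
    using D_nonneg by (intro mult_left_mono) auto
  then have "bregman h (grad f x') (- v) \<le> bregman h (grad f x) (- v) + 2 * D * (L * (2 * D * \<gamma>))"
    using bregman_diff_le[of "grad f x'" "- v" "grad f x"] by linarith
  then have "\<gamma> * bregman h (grad f x') (- v) \<le> \<gamma> * (bregman h (grad f x) (- v) + 2 * D * (L * (2 * D * \<gamma>)))"
    using \<open>\<gamma> > 0\<close> by (intro mult_left_mono) auto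
  moreover have "\<gamma> * bregman h (grad f x) d \<le> \<gamma> * ((norm (grad f x - d))\<^sup>2 / (2 * \<mu>))"
    using \<open>\<gamma> > 0\<close> bregman_le by (intro mult_left_mono) auto
  ultimately show "\<gamma> * bregman h (grad f x') (- v)
      \<le> (f x + G) - (f x' + G') + \<gamma> * ((norm (grad f x - d))\<^sup>2 / (2 * \<mu>)) + 8 * L * D\<^sup>2 * \<gamma>\<^sup>2"
    using g_le f_le sq ip ex by (simp add: power2_eq_square algebra_simps)
qed

text \<open>\<open>\<nabla>\<phi>\<close> is continuous on the interior of the domain only, so the composition has to be
restricted to it.\<close>
lemma borel_measurable_bregman:
  assumes [measurable]: "a \<in> borel_measurable M" "r \<in> borel_measurable M"
    and r: "\<And>\<omega>. \<omega> \<in> space M \<Longrightarrow> r \<omega> \<in> interior (edom \<phi>)"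
  shows "(\<lambda>\<omega>. bregman h (a \<omega>) (grad \<phi>r (r \<omega>))) \<in> borel_measurable M"
proof -
  have [measurable]: "h \<in> borel_measurable borel" "grad h \<in> borel_measurable borel"
    by (rule borel_measurable_continuous_onI[OF continuous_conjugate])
      (rule borel_measurable_continuous_onI[OF continuous_grad_conjugate])
  have "continuous_on (interior (edom \<phi>)) (grad \<phi>r)"
    using reference by (simp add: reference_function_def C1_on_def \<phi>r_def)
  then have "(\<lambda>z. indicator (interior (edom \<phi>)) z *\<^sub>R grad \<phi>r z) \<in> borel_measurable borel"
    by (intro borel_measurable_continuous_on_indicator) auto
  then have "(\<lambda>\<omega>. indicator (interior (edom \<phi>)) (r \<omega>) *\<^sub>R grad \<phi>r (r \<omega>)) \<in> borel_measurable M"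
    by (rule measurable_compose[rotated]) simp
  then have [measurable]: "(\<lambda>\<omega>. grad \<phi>r (r \<omega>)) \<in> borel_measurable M"
    by (subst measurable_cong[where g="\<lambda>\<omega>. indicator (interior (edom \<phi>)) (r \<omega>) *\<^sub>R grad \<phi>r (r \<omega>)"]) (auto simp: r)
  show ?thesis unfolding bregman_def by measurable
qed

end

section \<open>Second moments under a fresh sample\<close>

text \<open>Centred noise is orthogonal to constants. An infinite second moment makes the bound trivial.\<close>
lemma (in prob_space) second_moment_shift_le:
  fixes W :: "'a \<Rightarrow> 'b::euclidean_space"
  assumes int: "integrable M W" and mean: "expectation W = 0"
  shows "(\<integral>\<^sup>+s. ennreal ((norm (a + W s))\<^sup>2) \<partial>M) \<le> ennreal ((norm a)\<^sup>2) + (\<integral>\<^sup>+s. ennreal ((norm (W s))\<^sup>2) \<partial>M)"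
proof (cases "(\<integral>\<^sup>+s. ennreal ((norm (W s))\<^sup>2) \<partial>M) < \<infinity>")
  case True
  have [measurable]: "W \<in> borel_measurable M" using int by auto
  have sq: "integrable M (\<lambda>s. (norm (W s))\<^sup>2)"
    using True by (intro integrableI_bounded) auto
  have ip: "integrable M (\<lambda>s. inner a (W s))" using int by simp
  have eq: "(norm (a + W s))\<^sup>2 = (norm a)\<^sup>2 + 2 * inner a (W s) + (norm (W s))\<^sup>2" for s
    by (simp add: power2_norm_eq_inner inner_add_left inner_add_right inner_commute)
  have "(\<integral>\<^sup>+s. ennreal ((norm (a + W s))\<^sup>2) \<partial>M) = ennreal (expectation (\<lambda>s. (norm (a + W s))\<^sup>2))"
    by (intro nn_integral_eq_integral AE_I2 zero_le_power2) (simp add: eq sq ip)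
  also have "expectation (\<lambda>s. (norm (a + W s))\<^sup>2) = (norm a)\<^sup>2 + 2 * inner a (expectation W) + expectation (\<lambda>s. (norm (W s))\<^sup>2)"
    by (simp add: eq sq ip int prob_space)
  also have "ennreal \<dots> = ennreal ((norm a)\<^sup>2) + ennreal (expectation (\<lambda>s. (norm (W s))\<^sup>2))"
    by (simp add: mean ennreal_plus)
  also have "ennreal (expectation (\<lambda>s. (norm (W s))\<^sup>2)) = (\<integral>\<^sup>+s. ennreal ((norm (W s))\<^sup>2) \<partial>M)"
    by (rule nn_integral_eq_integral[symmetric]) (auto simp: sq)
  finally show ?thesis by simp
qed (simp add: not_less top_unique)

text \<open>Independence of \<open>X\<close> from the whole sigma-algebra \<open>B\<close> makes the joint law with any
\<open>B\<close>-measurable \<open>Y\<close> a product, so Tonelli's theorem integrates \<open>X\<close> out first. This replaces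
conditioning on the past.\<close>
lemma (in prob_space) nn_integral_fresh_sample:
  assumes P: "prob_space P"
    and indep: "indep_set (sets (vimage_algebra (space M) X P)) (sets B)"
    and X[measurable]: "X \<in> measurable M P" and law: "distr M P X = P"
    and B: "space B = space M" and Y: "Y \<in> measurable B N"
    and F[measurable]: "F \<in> borel_measurable (N \<Otimes>\<^sub>M P)"
  shows "(\<integral>\<^sup>+\<omega>. F (Y \<omega>, X \<omega>) \<partial>M) = (\<integral>\<^sup>+\<omega>. (\<integral>\<^sup>+s. F (Y \<omega>, s) \<partial>P) \<partial>M)"
proof -
  interpret P: prob_space P by fact
  have "sets B \<subseteq> events" by (rule indep_setD_ev2[OF indep])
  then have "subalgebra M B" using B by (simp add: subalgebra_def)
  then have YM[measurable]: "Y \<in> measurable M N"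
    using Y by (rule measurable_from_subalg)
  interpret Y: prob_space "distr M N Y" by (rule prob_space_distr) simp
  interpret pair: pair_sigma_finite P "distr M N Y" ..
  have joint: "P \<Otimes>\<^sub>M distr M N Y = distr M (P \<Otimes>\<^sub>M N) (\<lambda>\<omega>. (X \<omega>, Y \<omega>))"
  proof (rule pair_measure_eqI)
    fix A C assume A[measurable]: "A \<in> sets P" and "C \<in> sets (distr M N Y)"
    then have C[measurable]: "C \<in> sets N" by simp
    have "X -` A \<inter> space M \<in> sets (vimage_algebra (space M) X P)"
      using A by (rule in_vimage_algebra)
    moreover have "Y -` C \<inter> space M \<in> sets B"
      using measurable_sets[OF Y C] by (simp add: B)
    ultimately have "prob ((X -` A \<inter> space M) \<inter> (Y -` C \<inter> space M)) = prob (X -` A \<inter> space M) * prob (Y -` C \<inter> space M)"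
      by (rule indep_setD[OF indep])
    moreover have "emeasure P A = emeasure M (X -` A \<inter> space M)"
      by (subst law[symmetric], rule emeasure_distr) auto
    moreover have "(\<lambda>\<omega>. (X \<omega>, Y \<omega>)) -` (A \<times> C) \<inter> space M = (X -` A \<inter> space M) \<inter> (Y -` C \<inter> space M)"
      by auto
    ultimately show "emeasure P A * emeasure (distr M N Y) C
        = emeasure (distr M (P \<Otimes>\<^sub>M N) (\<lambda>\<omega>. (X \<omega>, Y \<omega>))) (A \<times> C)"
      by (simp add: emeasure_distr emeasure_eq_measure ennreal_mult)
  qed (unfold_locales, simp)
  have "(\<integral>\<^sup>+\<omega>. F (Y \<omega>, X \<omega>) \<partial>M) = (\<integral>\<^sup>+(s, z). F (z, s) \<partial>distr M (P \<Otimes>\<^sub>M N) (\<lambda>\<omega>. (X \<omega>, Y \<omega>)))"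
    by (simp add: nn_integral_distr)
  also have "\<dots> = (\<integral>\<^sup>+z. (\<integral>\<^sup>+s. F (z, s) \<partial>P) \<partial>distr M N Y)"
    unfolding joint[symmetric] by (subst pair.nn_integral_snd[symmetric]) auto
  also have "\<dots> = (\<integral>\<^sup>+\<omega>. (\<integral>\<^sup>+s. F (Y \<omega>, s) \<partial>P) \<partial>M)"
    by (simp add: nn_integral_distr)
  finally show ?thesis .
qed

text \<open>One step of the estimator error with the past frozen: \<open>e\<close> is the old error, \<open>z\<close> the new
iterate and \<open>z'\<close> the old one. The noise splits into a part with the oracle variance,
damped by \<open>\<alpha>\<close>, and a gradient difference at a common sample, which is Lipschitz in
\<open>z - z'\<close>. As it is centred, it adds to the old error in squares; the factor
\<open>(1 - \<alpha>)\<^sup>2 \<le> 1 - \<alpha>\<close> damps the latter.\<close>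
lemma recursive_momentum_second_moment:
  fixes G :: "'a::euclidean_space \<Rightarrow> 's \<Rightarrow> 'a" and m :: "'a \<Rightarrow> 'a"
  assumes P: "prob_space P"
    and int: "\<And>z. integrable P (G z)" and mean: "\<And>z. (\<integral>s. G z s \<partial>P) = m z"
    and var: "\<And>z. (\<integral>\<^sup>+s. ennreal ((norm (G z s - m z))\<^sup>2) \<partial>P) \<le> ennreal (\<sigma>\<^sup>2)"
    and Lip: "AE s in P. \<forall>z z'. norm (G z s - G z' s) \<le> L * norm (z - z')"
    and mLip: "norm (m z - m z') \<le> L * norm (z - z')"
    and \<alpha>: "0 \<le> \<alpha>" "\<alpha> \<le> 1"
  shows "(\<integral>\<^sup>+s. ennreal ((norm ((1 - \<alpha>) *\<^sub>R e + \<alpha> *\<^sub>R (G z s - m z)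
      + (1 - \<alpha>) *\<^sub>R (G z s - G z' s - (m z - m z'))))\<^sup>2) \<partial>P)
    \<le> ennreal (1 - \<alpha>) * ennreal ((norm e)\<^sup>2)
       + ennreal (2 * \<alpha>\<^sup>2 * \<sigma>\<^sup>2 + 8 * L\<^sup>2 * (norm (z - z'))\<^sup>2)"
proof -
  interpret prob_space P by fact
  define W where "W s = \<alpha> *\<^sub>R (G z s - m z) + (1 - \<alpha>) *\<^sub>R (G z s - G z' s - (m z - m z'))" for s
  have [measurable]: "G z \<in> borel_measurable P" for z
    using int[of z] by (rule borel_measurable_integrable)
  have W: "integrable P W" "expectation W = 0"
    unfolding W_def by (simp_all add: int mean prob_space)
  have "(norm (W s))\<^sup>2 \<le> 2 * \<alpha>\<^sup>2 * (norm (G z s - m z))\<^sup>2 + 8 * L\<^sup>2 * (norm (z - z'))\<^sup>2"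
    if s: "\<forall>z z'. norm (G z s - G z' s) \<le> L * norm (z - z')" for s
  proof -
    let ?a = "\<alpha> * norm (G z s - m z)" and ?b = "2 * L * norm (z - z')"
    have "norm (G z s - G z' s - (m z - m z')) \<le> ?b"
      using norm_triangle_ineq4[of "G z s - G z' s" "m z - m z'"] s[rule_format, of z z'] mLip by linarith
    then have "(1 - \<alpha>) * norm (G z s - G z' s - (m z - m z')) \<le> 1 * ?b"
      using \<alpha> by (intro mult_mono) auto
    then have "norm (W s) \<le> ?a + ?b"
      unfolding W_def using \<alpha> by (intro order_trans[OF norm_triangle_ineq]) simp
    then have "(norm (W s))\<^sup>2 \<le> (?a + ?b)\<^sup>2" by (intro power_mono) auto
    also have "\<dots> \<le> 2 * ?a\<^sup>2 + 2 * ?b\<^sup>2"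
      using zero_le_power2[of "?a - ?b"] by (simp add: power2_sum power2_diff)
    finally show ?thesis by (simp add: power_mult_distrib)
  qed
  then have "(\<integral>\<^sup>+s. ennreal ((norm (W s))\<^sup>2) \<partial>P)
      \<le> (\<integral>\<^sup>+s. ennreal (2 * \<alpha>\<^sup>2) * ennreal ((norm (G z s - m z))\<^sup>2) + ennreal (8 * L\<^sup>2 * (norm (z - z'))\<^sup>2) \<partial>P)"
    using Lip by (intro nn_integral_mono_AE)
      (auto simp: ennreal_mult[symmetric] ennreal_plus[symmetric] simp del: ennreal_plus elim!: eventually_mono intro!: ennreal_leI)
  also have "\<dots> = ennreal (2 * \<alpha>\<^sup>2) * (\<integral>\<^sup>+s. ennreal ((norm (G z s - m z))\<^sup>2) \<partial>P) + ennreal (8 * L\<^sup>2 * (norm (z - z'))\<^sup>2)"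
    by (simp add: nn_integral_add nn_integral_cmult emeasure_space_1)
  also have "\<dots> \<le> ennreal (2 * \<alpha>\<^sup>2) * ennreal (\<sigma>\<^sup>2) + ennreal (8 * L\<^sup>2 * (norm (z - z'))\<^sup>2)"
    by (intro add_mono mult_left_mono var) auto
  also have "\<dots> = ennreal (2 * \<alpha>\<^sup>2 * \<sigma>\<^sup>2 + 8 * L\<^sup>2 * (norm (z - z'))\<^sup>2)"
    by (simp add: ennreal_mult[symmetric] ennreal_plus[symmetric] del: ennreal_plus)
  finally have Wsq: "(\<integral>\<^sup>+s. ennreal ((norm (W s))\<^sup>2) \<partial>P) \<le> ennreal (2 * \<alpha>\<^sup>2 * \<sigma>\<^sup>2 + 8 * L\<^sup>2 * (norm (z - z'))\<^sup>2)" .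
  have "(norm ((1 - \<alpha>) *\<^sub>R e))\<^sup>2 \<le> (1 - \<alpha>) * (norm e)\<^sup>2"
  proof -
    have "(1 - \<alpha>)\<^sup>2 \<le> 1 - \<alpha>" using \<alpha> by (simp add: power2_eq_square mult_left_le)
    then show ?thesis by (simp add: power_mult_distrib mult_right_mono)
  qed
  then have "ennreal ((norm ((1 - \<alpha>) *\<^sub>R e))\<^sup>2) \<le> ennreal (1 - \<alpha>) * ennreal ((norm e)\<^sup>2)"
    using \<alpha> by (simp add: ennreal_mult[symmetric] ennreal_leI)
  with second_moment_shift_le[OF W, of "(1 - \<alpha>) *\<^sub>R e"] Wsq
  show ?thesis
    unfolding W_def add.assoc[symmetric] by (meson add_mono order_trans)
qed

section \<open>Step sizes\<close>

text \<open>The recursion \<open>E' \<le> (1 - \<beta>') E + C \<beta>'\<^sup>2\<close> preserves \<open>E \<le> 3 C \<beta>\<close>. Concavity of \<open>t powr (2/3)\<close>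
gives \<open>1 / \<beta>' - 1 / \<beta> \<le> 2/3\<close>, so \<open>1 / \<beta>\<close> grows by strictly less than \<open>1\<close> per step; the slack
\<open>1/3\<close> absorbs the noise and dictates the factor \<open>3\<close>.\<close>
lemma stepsize_contraction:
  fixes k :: nat
  defines "\<beta> \<equiv> \<lambda>n::nat. (real n + 1) powr (- 2 / 3)"
  shows "(1 - \<beta> (Suc k)) * (3 * \<beta> k) + (\<beta> (Suc k))\<^sup>2 \<le> 3 * \<beta> (Suc k)"
proof -
  define a b where "a = \<beta> (Suc k)" and "b = \<beta> k"
  have pos: "a > 0" "b > 0" by (auto simp: a_def b_def \<beta>_def)
  have "a \<le> 1" by (auto simp: a_def \<beta>_def powr_le1 powr_minus_divide ge_one_powr_ge_zero)
  have "1 / a - 1 / b \<le> 2 / 3"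
  proof -
    have inv: "1 / a = (real k + 2) powr (2 / 3)" "1 / b = (real k + 1) powr (2 / 3)"
      by (simp_all add: a_def b_def \<beta>_def powr_minus_divide add.commute)
    have "((\<lambda>t. t powr (2 / 3)) has_real_derivative 2 / 3 * t powr (2 / 3 - 1)) (at t)"
      if "real k + 1 \<le> t" for t
      using that by (intro has_real_derivative_powr) auto
    then obtain z where z: "real k + 1 < z" "z < real k + 2"
      "(real k + 2) powr (2 / 3) - (real k + 1) powr (2 / 3)
        = (real k + 2 - (real k + 1)) * (2 / 3 * z powr (2 / 3 - 1))"
      using MVT2[of "real k + 1" "real k + 2" "\<lambda>t. t powr (2 / 3)" "\<lambda>t. 2 / 3 * t powr (2 / 3 - 1)"]
      by auto
    have "z powr (2 / 3 - 1) \<le> 1" using z by (simp add: powr_le1 powr_minus_divide ge_one_powr_ge_zero)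
    with z inv show ?thesis by simp
  qed
  then have "b * (1 - 2 * a / 3) \<le> a" using pos by (simp add: field_simps)
  then have 1: "b * (1 - 2 * a / 3) * (1 - a / 3) \<le> a * (1 - a / 3)"
    using \<open>a \<le> 1\<close> by (intro mult_right_mono) auto
  have "b * (1 - a) \<le> b * ((1 - 2 * a / 3) * (1 - a / 3))"
    using pos by (intro mult_left_mono) (simp_all add: algebra_simps)
  with 1 have "b * (1 - a) \<le> a * (1 - a / 3)" by (simp add: mult.assoc)
  then show ?thesis unfolding a_def[symmetric] b_def[symmetric]
    by (simp add: algebra_simps power2_eq_square)
qed

lemma stepsize_ratio:
  fixes k :: nat
  defines "\<beta> \<equiv> \<lambda>n::nat. (real n + 1) powr (- 2 / 3)"
  shows "\<beta> k \<le> 2 * \<beta> (Suc k)"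
proof -
  have "(real k + 2) powr (2 / 3) \<le> (2 * (real k + 1)) powr (2 / 3)"
    by (intro powr_mono2) auto
  also have "\<dots> = 2 powr (2 / 3) * (real k + 1) powr (2 / 3)" by (rule powr_mult; simp)
  also have "\<dots> \<le> 2 powr 1 * (real k + 1) powr (2 / 3)"
    by (intro mult_right_mono powr_mono) auto
  finally have "(real k + 2) powr (2 / 3) \<le> 2 * (real k + 1) powr (2 / 3)" by simp
  then show ?thesis by (simp add: \<beta>_def powr_minus_divide field_simps add.commute)
qed

text \<open>The exponent \<open>-4/3\<close> makes the series converge; hence no logarithm appears in the rate.\<close>
lemma stepsize_square_sums_bounded:
  "\<exists>S::real. S \<ge> 0 \<and> (\<forall>K. (\<Sum>k\<le>K. ((real k + 1) powr (- 2 / 3))\<^sup>2) \<le> S)"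
proof -
  have "summable (\<lambda>n. real (Suc n) powr (- 4 / 3))"
    using summable_Suc_iff[of "\<lambda>n. real n powr (- 4 / 3)"] by (simp add: summable_real_powr_iff)
  moreover have "((real k + 1) powr (- 2 / 3))\<^sup>2 = real (Suc k) powr (- 4 / 3)" for k :: nat
    by (simp add: powr_power add.commute)
  ultimately have "summable (\<lambda>k. ((real k + 1) powr (- 2 / 3))\<^sup>2)" by simp
  then show ?thesis
    by (intro exI[of _ "\<Sum>k. ((real k + 1) powr (- 2 / 3))\<^sup>2"])
      (auto intro!: sum_le_suminf suminf_nonneg)
qed

section \<open>The error of the recursive momentum estimator\<close>

lemma measurable_uncurried:
  assumes "(\<lambda>(z, s). G z s) \<in> measurable (A \<Otimes>\<^sub>M P) B" "X \<in> measurable N A" "S \<in> measurable N P"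
  shows "(\<lambda>\<omega>. G (X \<omega>) (S \<omega>)) \<in> measurable N B"
  using measurable_compose[OF measurable_Pair[OF assms(2,3)] assms(1)] by simp

text \<open>A measure space carrying the sigma-algebra of the past, so that measurability with respect to
it can be derived by the usual closure rules.\<close>
lemma measurable_past:
  assumes "\<And>i. \<xi> i \<in> measurable M P"
  obtains B where "space B = space M" "sets B = past M P \<xi> x k"
    "\<And>i. i < k \<Longrightarrow> \<xi> i \<in> measurable B P"
    "\<And>i. i \<le> k \<Longrightarrow> x i \<in> borel_measurable B"
proof -
  let ?Q = "PiM {..<k} (\<lambda>_. P) \<Otimes>\<^sub>M PiM {..k} (\<lambda>_. borel)"
  let ?Z = "\<lambda>\<omega>. (\<lambda>i\<in>{..<k}. \<xi> i \<omega>, \<lambda>i\<in>{..k}. x i \<omega>)"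
  let ?B = "vimage_algebra (space M) ?Z ?Q"
  have "?Z \<in> space M \<rightarrow> space ?Q"
    using measurable_space[OF assms] by (auto simp: space_pair_measure space_PiM)
  then have Z: "?Z \<in> measurable ?B ?Q" by (rule measurable_vimage_algebra1)
  show thesis
  proof
    show "space ?B = space M" "sets ?B = past M P \<xi> x k" by (simp_all add: past_def)
    show "\<xi> i \<in> measurable ?B P" if "i < k" for i
    proof -
      have "(\<lambda>q. fst q i) \<in> measurable ?Q P"
        using that by (intro measurable_compose[OF measurable_fst measurable_component_singleton]) auto
      from measurable_compose[OF Z this] show ?thesis using that by simp
    qed
    show "x i \<in> borel_measurable ?B" if "i \<le> k" for i
    proof -
      have "(\<lambda>q. snd q i) \<in> borel_measurable ?Q"
        using that by (intro measurable_compose[OF measurable_snd measurable_component_singleton]) auto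
      from measurable_compose[OF Z this] show ?thesis using that by simp
    qed
  qed
qed

text \<open>What the estimator sees of the algorithm: every sample is fresh given the past, which
contains the current iterate, and consecutive iterates are at distance of order \<open>\<beta>\<close>. Isolating
this interface separates the stochastic estimate from duality and from the backward step.\<close>
locale recursive_momentum =
  fixes P :: "'s measure" and M :: "'w measure" and \<xi> :: "nat \<Rightarrow> 'w \<Rightarrow> 's"
    and G :: "'a::euclidean_space \<Rightarrow> 's \<Rightarrow> 'a" and m :: "'a \<Rightarrow> 'a"
    and x d :: "nat \<Rightarrow> 'w \<Rightarrow> 'a" and x0 :: 'a and L \<sigma> R :: real and \<beta> :: "nat \<Rightarrow> real"
  assumes P: "prob_space P" and M: "prob_space M"
    and G_measurable: "(\<lambda>(z, s). G z s) \<in> borel_measurable (borel \<Otimes>\<^sub>M P)"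
    and G_integrable: "\<And>z. integrable P (G z)"
    and G_mean: "\<And>z. (\<integral>s. G z s \<partial>P) = m z"
    and G_variance: "\<And>z. (\<integral>\<^sup>+s. ennreal ((norm (G z s - m z))\<^sup>2) \<partial>P) \<le> ennreal (\<sigma>\<^sup>2)"
    and G_Lipschitz: "AE s in P. \<forall>z z'. norm (G z s - G z' s) \<le> L * norm (z - z')"
    and m_Lipschitz: "\<And>z z'. norm (m z - m z') \<le> L * norm (z - z')"
    and m_measurable: "m \<in> borel_measurable borel"
    and sample: "\<And>k. \<xi> k \<in> measurable M P" and law: "\<And>k. distr M P (\<xi> k) = P"
    and fresh: "\<And>k. prob_space.indep_set M (sets (vimage_algebra (space M) (\<xi> k) P)) (past M P \<xi> x k)"
    and \<beta>_def: "\<And>k. \<beta> k = (real k + 1) powr (- 2 / 3)"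
    and x_measurable: "\<And>k. x k \<in> borel_measurable M"
    and x_0: "\<And>\<omega>. \<omega> \<in> space M \<Longrightarrow> x 0 \<omega> = x0"
    and x_step: "\<And>k \<omega>. \<omega> \<in> space M \<Longrightarrow> norm (x (Suc k) \<omega> - x k \<omega>) \<le> R * \<beta> k"
    and d_0: "\<And>\<omega>. \<omega> \<in> space M \<Longrightarrow> d 0 \<omega> = G (x 0 \<omega>) (\<xi> 0 \<omega>)"
    and d_Suc: "\<And>k \<omega>. \<omega> \<in> space M \<Longrightarrow>
      d (Suc k) \<omega> = (1 - \<beta> (Suc k)) *\<^sub>R d k \<omega> + \<beta> (Suc k) *\<^sub>R G (x (Suc k) \<omega>) (\<xi> (Suc k) \<omega>)
        + (1 - \<beta> (Suc k)) *\<^sub>R (G (x (Suc k) \<omega>) (\<xi> (Suc k) \<omega>) - G (x k \<omega>) (\<xi> (Suc k) \<omega>))"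
begin

lemma estimator_adapted:
  assumes "space B = space M" and "\<And>i. i \<le> k \<Longrightarrow> \<xi> i \<in> measurable B P"
    and "\<And>i. i \<le> k \<Longrightarrow> x i \<in> borel_measurable B"
  shows "d k \<in> borel_measurable B"
  using assms(2,3)
proof (induction k)
  case 0
  have "(\<lambda>\<omega>. G (x 0 \<omega>) (\<xi> 0 \<omega>)) \<in> borel_measurable B"
    using 0 by (intro measurable_uncurried[OF G_measurable]) auto
  then show ?case by (subst measurable_cong[OF d_0]) (auto simp: assms(1))
next
  case (Suc k)
  have "d k \<in> borel_measurable B" using Suc by auto
  moreover have "(\<lambda>\<omega>. G (x (Suc k) \<omega>) (\<xi> (Suc k) \<omega>)) \<in> borel_measurable B"
    "(\<lambda>\<omega>. G (x k \<omega>) (\<xi> (Suc k) \<omega>)) \<in> borel_measurable B"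
    using Suc.prems by (auto intro!: measurable_uncurried[OF G_measurable])
  ultimately show ?case by (subst measurable_cong[OF d_Suc]) (auto simp: assms(1))
qed

lemma estimator_measurable: "d k \<in> borel_measurable M"
  using sample x_measurable by (intro estimator_adapted) auto

lemma stepsize_bounds: "0 < \<beta> k" "\<beta> k \<le> 1"
  by (auto simp: \<beta>_def powr_le1 powr_minus_divide ge_one_powr_ge_zero)

text \<open>The error before step \<open>k + 1\<close> and the two iterates involved belong to the past, so the fresh
sample can be integrated out with them fixed. The bound \<open>R \<beta> k\<close> on their distance is at most
\<open>2 R \<beta> (k + 1)\<close>, which turns \<open>8 L\<^sup>2\<close> into \<open>32 L\<^sup>2\<close>.\<close>
lemma error_second_moment_Suc:
  "(\<integral>\<^sup>+\<omega>. ennreal ((norm (d (Suc k) \<omega> - m (x (Suc k) \<omega>)))\<^sup>2) \<partial>M)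
    \<le> ennreal (1 - \<beta> (Suc k)) * (\<integral>\<^sup>+\<omega>. ennreal ((norm (d k \<omega> - m (x k \<omega>)))\<^sup>2) \<partial>M)
       + ennreal ((2 * \<sigma>\<^sup>2 + 32 * L\<^sup>2 * R\<^sup>2) * (\<beta> (Suc k))\<^sup>2)"
proof -
  interpret prob_space M by (rule M)
  note [measurable (raw)] = measurable_uncurried[OF G_measurable]
  note [measurable] = m_measurable estimator_measurable x_measurable
  let ?b = "\<beta> (Suc k)"
  let ?C = "2 * \<sigma>\<^sup>2 + 32 * L\<^sup>2 * R\<^sup>2"
  obtain B where B: "space B = space M" "sets B = past M P \<xi> x (Suc k)"
    "\<And>i. i < Suc k \<Longrightarrow> \<xi> i \<in> measurable B P" "\<And>i. i \<le> Suc k \<Longrightarrow> x i \<in> borel_measurable B"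
    by (rule measurable_past[where \<xi>=\<xi> and x=x and k="Suc k", OF sample]) blast
  define err where "err \<omega> = d k \<omega> - m (x k \<omega>)" for \<omega>
  define Y where "Y \<omega> = (err \<omega>, x (Suc k) \<omega>, x k \<omega>)" for \<omega>
  have "d k \<in> borel_measurable B" by (rule estimator_adapted) (auto simp: B)
  moreover have "x k \<in> borel_measurable B" "x (Suc k) \<in> borel_measurable B" by (auto simp: B)
  ultimately have Y: "Y \<in> measurable B (borel \<Otimes>\<^sub>M borel \<Otimes>\<^sub>M borel)"
    unfolding Y_def err_def by measurable
  define F where "F = (\<lambda>((e, z, z'), s). ennreal ((norm ((1 - ?b) *\<^sub>R e + ?b *\<^sub>R (G z s - m z)
      + (1 - ?b) *\<^sub>R (G z s - G z' s - (m z - m z'))))\<^sup>2))"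
  have F: "F \<in> borel_measurable ((borel \<Otimes>\<^sub>M borel \<Otimes>\<^sub>M borel) \<Otimes>\<^sub>M P)"
    unfolding F_def case_prod_beta' by measurable
  have "(\<integral>\<^sup>+\<omega>. ennreal ((norm (d (Suc k) \<omega> - m (x (Suc k) \<omega>)))\<^sup>2) \<partial>M) = (\<integral>\<^sup>+\<omega>. F (Y \<omega>, \<xi> (Suc k) \<omega>) \<partial>M)"
    by (intro nn_integral_cong) (simp add: F_def Y_def err_def d_Suc algebra_simps)
  also have "\<dots> = (\<integral>\<^sup>+\<omega>. (\<integral>\<^sup>+s. F (Y \<omega>, s) \<partial>P) \<partial>M)"
    using fresh[of "Suc k"] unfolding B(2)[symmetric]
    by (rule nn_integral_fresh_sample[OF P _ sample law B(1) Y F])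
  also have "\<dots> \<le> (\<integral>\<^sup>+\<omega>. ennreal (1 - ?b) * ennreal ((norm (err \<omega>))\<^sup>2) + ennreal (?C * ?b\<^sup>2) \<partial>M)"
  proof (rule nn_integral_mono)
    fix \<omega> assume \<omega>: "\<omega> \<in> space M"
    let ?n = "norm (x (Suc k) \<omega> - x k \<omega>)"
    have "?n \<le> R * \<beta> k" by (rule x_step[OF \<omega>])
    then have "?n\<^sup>2 \<le> (R * \<beta> k)\<^sup>2" by (intro power_mono) auto
    also have "\<dots> \<le> R\<^sup>2 * (2 * ?b)\<^sup>2"
      using stepsize_ratio[of k] stepsize_bounds[of k]
      unfolding power_mult_distrib[of R] by (intro mult_left_mono power_mono) (auto simp: \<beta>_def)
    finally have "8 * L\<^sup>2 * ?n\<^sup>2 \<le> 8 * L\<^sup>2 * (R\<^sup>2 * (2 * ?b)\<^sup>2)" by (intro mult_left_mono) auto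
    then have "2 * ?b\<^sup>2 * \<sigma>\<^sup>2 + 8 * L\<^sup>2 * ?n\<^sup>2 \<le> ?C * ?b\<^sup>2" by (simp add: algebra_simps)
    then show "(\<integral>\<^sup>+s. F (Y \<omega>, s) \<partial>P) \<le> ennreal (1 - ?b) * ennreal ((norm (err \<omega>))\<^sup>2) + ennreal (?C * ?b\<^sup>2)"
      using recursive_momentum_second_moment[OF P G_integrable G_mean G_variance G_Lipschitz m_Lipschitz,
          of ?b "err \<omega>" "x (Suc k) \<omega>" "x k \<omega>"] stepsize_bounds[of "Suc k"]
      unfolding F_def Y_def by (auto elim!: order_trans intro!: add_left_mono ennreal_leI simp del: ennreal_plus)
  qed
  also have "\<dots> = ennreal (1 - ?b) * (\<integral>\<^sup>+\<omega>. ennreal ((norm (err \<omega>))\<^sup>2) \<partial>M) + ennreal (?C * ?b\<^sup>2)"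
    unfolding err_def by (simp add: nn_integral_add nn_integral_cmult emeasure_space_1)
  finally show ?thesis by (simp add: err_def)
qed

lemma error_second_moment:
  "(\<integral>\<^sup>+\<omega>. ennreal ((norm (d k \<omega> - m (x k \<omega>)))\<^sup>2) \<partial>M)
    \<le> ennreal (3 * (2 * \<sigma>\<^sup>2 + 32 * L\<^sup>2 * R\<^sup>2) * \<beta> k)"
proof (induction k)
  case 0
  interpret prob_space M by (rule M)
  note [measurable (raw)] = measurable_uncurried[OF G_measurable]
  note [measurable] = sample[of 0]
  have "(\<integral>\<^sup>+\<omega>. ennreal ((norm (d 0 \<omega> - m (x 0 \<omega>)))\<^sup>2) \<partial>M)
      = (\<integral>\<^sup>+\<omega>. ennreal ((norm (G x0 (\<xi> 0 \<omega>) - m x0))\<^sup>2) \<partial>M)"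
    by (intro nn_integral_cong) (simp add: d_0 x_0)
  also have "\<dots> = (\<integral>\<^sup>+s. ennreal ((norm (G x0 s - m x0))\<^sup>2) \<partial>distr M P (\<xi> 0))"
    by (simp add: nn_integral_distr)
  also have "\<dots> \<le> ennreal (\<sigma>\<^sup>2)" unfolding law by (rule G_variance)
  also have "\<dots> \<le> ennreal (3 * (2 * \<sigma>\<^sup>2 + 32 * L\<^sup>2 * R\<^sup>2) * \<beta> 0)"
    by (rule ennreal_leI) (simp add: \<beta>_def)
  finally show ?case .
next
  case (Suc k)
  let ?C = "2 * \<sigma>\<^sup>2 + 32 * L\<^sup>2 * R\<^sup>2"
  let ?b = "\<beta> (Suc k)"
  have C: "?C \<ge> 0" by simp
  have "(\<integral>\<^sup>+\<omega>. ennreal ((norm (d (Suc k) \<omega> - m (x (Suc k) \<omega>)))\<^sup>2) \<partial>M)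
      \<le> ennreal (1 - ?b) * ennreal (3 * ?C * \<beta> k) + ennreal (?C * ?b\<^sup>2)"
    using error_second_moment_Suc[of k] Suc.IH by (meson add_mono mult_left_mono order_refl order_trans zero_le)
  also have "\<dots> = ennreal (?C * ((1 - ?b) * (3 * \<beta> k) + ?b\<^sup>2))"
  proof -
    have nonneg: "0 \<le> 1 - ?b" "0 \<le> 3 * ?C * \<beta> k" "0 \<le> ?C * ?b\<^sup>2"
      using stepsize_bounds[of "Suc k"] stepsize_bounds[of k] C by auto
    have "ennreal (1 - ?b) * ennreal (3 * ?C * \<beta> k) + ennreal (?C * ?b\<^sup>2)
        = ennreal ((1 - ?b) * (3 * ?C * \<beta> k) + ?C * ?b\<^sup>2)"
      using nonneg by (simp only: ennreal_mult[symmetric] ennreal_plus[symmetric] mult_nonneg_nonneg)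
    then show ?thesis by (simp add: algebra_simps)
  qed
  also have "\<dots> \<le> ennreal (?C * (3 * ?b))"
    using stepsize_contraction[of k] C by (intro ennreal_leI mult_left_mono) (simp_all add: \<beta>_def)
  also have "?C * (3 * ?b) = 3 * ?C * ?b" by simp
  finally show ?case .
qed

lemma error_integrable: "integrable M (\<lambda>\<omega>. (norm (d k \<omega> - m (x k \<omega>)))\<^sup>2)"
  and error_expectation: "(\<integral>\<omega>. (norm (d k \<omega> - m (x k \<omega>)))\<^sup>2 \<partial>M) \<le> 3 * (2 * \<sigma>\<^sup>2 + 32 * L\<^sup>2 * R\<^sup>2) * \<beta> k"
proof -
  note [measurable] = m_measurable estimator_measurable x_measurable
  show int: "integrable M (\<lambda>\<omega>. (norm (d k \<omega> - m (x k \<omega>)))\<^sup>2)"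
    using error_second_moment[of k]
    by (intro integrableI_bounded) (auto intro: le_less_trans)
  have "ennreal (\<integral>\<omega>. (norm (d k \<omega> - m (x k \<omega>)))\<^sup>2 \<partial>M) \<le> ennreal (3 * (2 * \<sigma>\<^sup>2 + 32 * L\<^sup>2 * R\<^sup>2) * \<beta> k)"
    using error_second_moment[of k] by (subst nn_integral_eq_integral[symmetric, OF int]) auto
  then show "(\<integral>\<omega>. (norm (d k \<omega> - m (x k \<omega>)))\<^sup>2 \<partial>M) \<le> 3 * (2 * \<sigma>\<^sup>2 + 32 * L\<^sup>2 * R\<^sup>2) * \<beta> k"
    using stepsize_bounds[of k] by (subst (asm) ennreal_le_iff) auto
qed

end

section \<open>Convergence rate of the gap\<close>

theorem theorem4p5:
  fixes f :: "'a::euclidean_space \<Rightarrow> real" and g \<phi> :: "'a \<Rightarrow> ereal"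
    and fs :: "'a \<Rightarrow> 's \<Rightarrow> real"
    and P :: "'s measure" and M :: "'w measure" and \<xi> :: "nat \<Rightarrow> 'w \<Rightarrow> 's"
    and x y d v :: "nat \<Rightarrow> 'w \<Rightarrow> 'a" and x0 :: 'a
    and L \<mu> \<sigma> :: real and \<alpha> \<gamma> :: "nat \<Rightarrow> real"
  assumes "L > 0" and "lipschitz_smooth L f"
    and "proper g" and "lsc g" and "prox_bounded g"
    and "(INF z. ereal (f z) + g z) > - \<infinity>"
    and "reference_function \<mu> \<phi>"
    and "(SUP z\<in>edom \<phi>. ereal (norm z)) < \<infinity>"
    \<comment> \<open>the law \<open>P\<close> of the random variable \<open>\<xi>\<close> and the stochastic gradient oracle\<close>
    and "prob_space P"
    and "(\<lambda>(z, s). grad (\<lambda>u. fs u s) z) \<in> borel_measurable (borel \<Otimes>\<^sub>M P)"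
    and "\<And>z. integrable P (\<lambda>s. grad (\<lambda>u. fs u s) z)"
    and "\<And>z. (\<integral>s. grad (\<lambda>u. fs u s) z \<partial>P) = grad f z"
    and "\<sigma> \<ge> 0"
    and "\<And>z. (\<integral>\<^sup>+s. ennreal ((norm (grad (\<lambda>u. fs u s) z - grad f z))\<^sup>2) \<partial>P) \<le> ennreal (\<sigma>\<^sup>2)"
    and "AE s in P. lipschitz_smooth L (\<lambda>u. fs u s)"
    \<comment> \<open>the samples\<close>
    and "prob_space M"
    and "\<And>k. \<xi> k \<in> measurable M P" and "\<And>k. distr M P (\<xi> k) = P"
    and "prob_space.indep_vars M (\<lambda>_. P) \<xi> UNIV"
    and "\<And>k. prob_space.indep_set M (sets (vimage_algebra (space M) (\<xi> k) P)) (past M P \<xi> x k)"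
    \<comment> \<open>the algorithm\<close>
    and "\<And>k. \<alpha> k = (real k + 1) powr (- 2 / 3)"
    and "\<And>k. \<gamma> k = (real k + 1) powr (- 2 / 3)"
    and "\<And>k. prox_threshold g > ereal (\<gamma> k / \<mu>)"
    and "x0 \<in> edom g" and "\<And>\<omega>. \<omega> \<in> space M \<Longrightarrow> x 0 \<omega> = x0"
    and "\<And>k. x k \<in> borel_measurable M"
    and "\<And>\<omega>. \<omega> \<in> space M \<Longrightarrow> d 0 \<omega> = grad (\<lambda>u. fs u (\<xi> 0 \<omega>)) (x 0 \<omega>)"
    and "\<And>k \<omega>. k \<ge> 1 \<Longrightarrow> \<omega> \<in> space M \<Longrightarrow>
      d k \<omega> = (1 - \<alpha> k) *\<^sub>R d (k - 1) \<omega> + \<alpha> k *\<^sub>R grad (\<lambda>u. fs u (\<xi> k \<omega>)) (x k \<omega>)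
        + (1 - \<alpha> k) *\<^sub>R (grad (\<lambda>u. fs u (\<xi> k \<omega>)) (x k \<omega>) - grad (\<lambda>u. fs u (\<xi> k \<omega>)) (x (k - 1) \<omega>))"
    and "\<And>k \<omega>. \<omega> \<in> space M \<Longrightarrow>
      y k \<omega> = x k \<omega> - \<gamma> k *\<^sub>R grad (finite_part (conjugate \<phi>)) (d k \<omega>)"
    and "\<And>k \<omega>. \<omega> \<in> space M \<Longrightarrow>
      is_arg_min (\<lambda>z. g z + epi_scale (\<gamma> k) \<phi> (z - y k \<omega>)) (\<lambda>_. True) (x (Suc k) \<omega>)"
    and "\<And>k \<omega>. \<omega> \<in> space M \<Longrightarrow>
      backward_subgradient \<phi> g (\<gamma> k) (y k \<omega>) (x (Suc k) \<omega>) (v (Suc k) \<omega>)"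
  shows "(\<forall>k. integrable M (\<lambda>\<omega>.
             bregman (finite_part (conjugate \<phi>)) (grad f (x (Suc k) \<omega>)) (- v (Suc k) \<omega>))) \<and>
    (\<exists>C q. C \<ge> 0 \<and> q \<ge> 0 \<and> (\<forall>K::nat.
       1 / (real K + 1) * (\<Sum>k\<le>K. \<integral>\<omega>.
           bregman (finite_part (conjugate \<phi>)) (grad f (x (Suc k) \<omega>)) (- v (Suc k) \<omega>) \<partial>M)
       \<le> C * (1 + ln (real K + 1)) powr q * (real K + 1) powr (- 1 / 3)))"
proof -
  note L = assms(1) and f = assms(2) and proper = assms(3) and F_bounded = assms(6)
    and \<xi>_meas = assms(17) and \<gamma>_def = assms(22) and x0 = assms(24) and x_0 = assms(25)
    and x_meas = assms(26) and d_0 = assms(27) and d_rec = assms(28) and y_eq = assms(29)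
    and argmin = assms(30) and backward = assms(31)
  have \<alpha>_eq: "\<alpha> = \<gamma>" using assms(21,22) by auto
  obtain D where D: "\<And>z. z \<in> edom \<phi> \<Longrightarrow> norm z \<le> D"
  proof -
    obtain r where r: "(SUP z\<in>edom \<phi>. ereal (norm z)) < ereal r" "ereal r < \<infinity>"
      using ereal_dense2[OF assms(8)] by (elim exE conjE)
    have "ereal (norm z) \<le> ereal r" if "z \<in> edom \<phi>" for z
      using less_imp_le[OF le_less_trans[OF SUP_upper[OF that] r(1)]] .
    then show thesis unfolding ereal_less_eq by (rule that)
  qed
  interpret bounded_reference \<mu> D \<phi>
    by unfold_locales (use assms(7) D in auto)
  interpret prob_space M by fact
  have \<gamma>_pos: "\<gamma> k > 0" for k by (simp add: \<gamma>_def)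
  have h_eq: "finite_part (conjugate \<phi>) = h" by (simp add: h_def)
  define gp where "gp k \<omega> = bregman h (grad f (x (Suc k) \<omega>)) (- v (Suc k) \<omega>)" for k \<omega>
  define err where "err k \<omega> = (norm (d k \<omega> - grad f (x k \<omega>)))\<^sup>2" for k \<omega>
  define Gr where "Gr k \<omega> = real_of_ereal (g (x k \<omega>))" for k \<omega>
  define F where "F k \<omega> = f (x k \<omega>) + Gr k \<omega>" for k \<omega>
  \<comment> \<open>Finite at later iterates because a subgradient exists there.\<close>
  have g_real: "g (x k \<omega>) = ereal (Gr k \<omega>)" if \<omega>: "\<omega> \<in> space M" for k \<omega>
  proof -
    have "\<bar>g (x k \<omega>)\<bar> \<noteq> \<infinity>"
    proof (cases k)
      case 0
      then show ?thesis using x_0[OF \<omega>] x0 proper by (auto simp: edom_def proper_def)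
    next
      case (Suc j)
      then show ?thesis using backward[OF \<omega>, of j]
        by (simp add: backward_subgradient_def limiting_subdifferential_def)
    qed
    then show ?thesis by (simp add: Gr_def ereal_real')
  qed
  obtain Fl where Fl: "\<And>k \<omega>. \<omega> \<in> space M \<Longrightarrow> Fl \<le> F k \<omega>"
  proof -
    obtain c where c: "ereal c \<le> (INF z. ereal (f z) + g z)"
      using F_bounded by (metis ereal_dense2 less_imp_le)
    have "ereal c \<le> ereal (f (x k \<omega>)) + g (x k \<omega>)" for k \<omega>
      using c by (rule order_trans) (rule INF_lower, simp)
    then have "c \<le> F k \<omega>" if "\<omega> \<in> space M" for k \<omega>
      using g_real[OF that, of k] unfolding F_def by (metis ereal_less_eq(3) plus_ereal.simps(1))
    then show thesis by (rule that)
  qed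
  define F0 where "F0 = f x0 + real_of_ereal (g x0)"
  have F0: "F 0 \<omega> = F0" if "\<omega> \<in> space M" for \<omega>
    using x_0[OF that] by (simp add: F_def Gr_def F0_def)
  have gd: "grad h (- v (Suc k) \<omega>) = inverse (\<gamma> k) *\<^sub>R (x (Suc k) \<omega> - y k \<omega>)"
    and step: "norm (x (Suc k) \<omega> - x k \<omega>) \<le> 2 * D * \<gamma> k"
    and descent: "\<gamma> k * gp k \<omega> \<le> F k \<omega> - F (Suc k) \<omega> + \<gamma> k * (err k \<omega> / (2 * \<mu>)) + 8 * L * D\<^sup>2 * (\<gamma> k)\<^sup>2"
    if \<omega>: "\<omega> \<in> space M" for k \<omega>
    using forward_backward_step[OF f \<gamma>_pos g_real[OF \<omega>] g_real[OF \<omega>] y_eq[OF \<omega>, unfolded h_eq]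
        argmin[OF \<omega>] backward[OF \<omega>]]
    by (simp_all add: gp_def F_def err_def norm_minus_commute)
  have v_eq: "- v (Suc k) \<omega> = grad \<phi>r (inverse (\<gamma> k) *\<^sub>R (x (Suc k) \<omega> - y k \<omega>))"
    and int: "inverse (\<gamma> k) *\<^sub>R (x (Suc k) \<omega> - y k \<omega>) \<in> interior (edom \<phi>)"
    if "\<omega> \<in> space M" for k \<omega>
    using backward[OF that, of k] by (auto simp: backward_subgradient_def \<phi>r_def)
  have grad_f_meas[measurable]: "grad f \<in> borel_measurable borel"
    using lipschitz_smooth_continuous_grad[OF f] by (rule borel_measurable_continuous_onI)
  interpret recursive_momentum P M \<xi> "\<lambda>z s. grad (\<lambda>u. fs u s) z" "grad f" x d x0 L \<sigma> "2 * D" \<gamma>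
  proof (rule recursive_momentum.intro)
    show "AE s in P. \<forall>z z'. norm (grad (\<lambda>u. fs u s) z - grad (\<lambda>u. fs u s) z') \<le> L * norm (z - z')"
      using assms(15) by eventually_elim (auto intro: lipschitz_smooth_grad_norm_diff_le)
  next
    show "norm (x (Suc k) \<omega> - x k \<omega>) \<le> 2 * D * \<gamma> k" if "\<omega> \<in> space M" for k \<omega>
      using that by (rule step)
  next
    fix k \<omega> assume "\<omega> \<in> space M"
    then show "d (Suc k) \<omega> = (1 - \<gamma> (Suc k)) *\<^sub>R d k \<omega> + \<gamma> (Suc k) *\<^sub>R grad (\<lambda>u. fs u (\<xi> (Suc k) \<omega>)) (x (Suc k) \<omega>)
      + (1 - \<gamma> (Suc k)) *\<^sub>R (grad (\<lambda>u. fs u (\<xi> (Suc k) \<omega>)) (x (Suc k) \<omega>) - grad (\<lambda>u. fs u (\<xi> (Suc k) \<omega>)) (x k \<omega>))"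
      using d_rec[of "Suc k" \<omega>] by (simp add: \<alpha>_eq)
  qed (rule assms(9-14,16-18,20) \<gamma>_def x_0 x_meas d_0 grad_f_meas
      lipschitz_smooth_grad_norm_diff_le[OF f]; assumption)+
  note [measurable] = x_meas estimator_measurable
  have gp_meas[measurable]: "gp k \<in> borel_measurable M" for k
  proof -
    have [measurable]: "grad h \<in> borel_measurable borel"
      by (rule borel_measurable_continuous_onI[OF continuous_grad_conjugate])
    have "(\<lambda>\<omega>. x k \<omega> - \<gamma> k *\<^sub>R grad h (d k \<omega>)) \<in> borel_measurable M" by measurable
    then have [measurable]: "y k \<in> borel_measurable M"
      by (subst measurable_cong[OF y_eq[unfolded h_eq]]) auto
    have "(\<lambda>\<omega>. bregman h (grad f (x (Suc k) \<omega>)) (grad \<phi>r (inverse (\<gamma> k) *\<^sub>R (x (Suc k) \<omega> - y k \<omega>)))) \<in> borel_measurable M"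
      by (rule borel_measurable_bregman) (use int in auto)
    then show ?thesis
      by (subst measurable_cong[where g="\<lambda>\<omega>. bregman h (grad f (x (Suc k) \<omega>)) (grad \<phi>r (inverse (\<gamma> k) *\<^sub>R (x (Suc k) \<omega> - y k \<omega>)))"])
        (auto simp: gp_def v_eq)
  qed
  have gp_nonneg: "0 \<le> gp k \<omega>" for k \<omega> by (simp add: gp_def bregman_nonneg)
  have err_int: "integrable M (err k)" for k
    using error_integrable[of k] by (simp add: err_def[abs_def])
  \<comment> \<open>A pathwise majorant of the weighted gaps. Telescoping before taking expectations
  avoids integrability of \<open>g\<close> along the iterates: the initial value is the constant \<open>F0\<close> and the
  final one is bounded below by \<open>Fl\<close>.\<close>
  define U where "U K \<omega> = (F0 - Fl) + (\<Sum>k\<le>K. \<gamma> k * (err k \<omega> / (2 * \<mu>)) + 8 * L * D\<^sup>2 * (\<gamma> k)\<^sup>2)" for K \<omega>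
  have U_int: "integrable M (U K)" for K
    unfolding U_def using err_int by (intro Bochner_Integration.integrable_add Bochner_Integration.integrable_sum) auto
  have telescoped: "(\<Sum>k\<le>K. \<gamma> k * gp k \<omega>) \<le> U K \<omega>" if \<omega>: "\<omega> \<in> space M" for K \<omega>
  proof -
    have "(\<Sum>k\<le>K. \<gamma> k * gp k \<omega>) \<le> (\<Sum>k\<le>K. (F k \<omega> - F (Suc k) \<omega>) + (\<gamma> k * (err k \<omega> / (2 * \<mu>)) + 8 * L * D\<^sup>2 * (\<gamma> k)\<^sup>2))"
      using descent[OF \<omega>] by (intro sum_mono) (simp add: algebra_simps)
    also have "\<dots> = (F 0 \<omega> - F (Suc K) \<omega>) + (\<Sum>k\<le>K. \<gamma> k * (err k \<omega> / (2 * \<mu>)) + 8 * L * D\<^sup>2 * (\<gamma> k)\<^sup>2)"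
      by (simp only: sum.distrib sum_telescope[of "\<lambda>k. F k \<omega>"])
    also have "\<dots> \<le> U K \<omega>"
      using F0[OF \<omega>] Fl[OF \<omega>, of "Suc K"] by (simp add: U_def)
    finally show ?thesis .
  qed
  have gp_int: "integrable M (gp k)" for k
  proof (rule Bochner_Integration.integrable_bound)
    show "integrable M (\<lambda>\<omega>. U k \<omega> / \<gamma> k)" using U_int by simp
    show "AE \<omega> in M. norm (gp k \<omega>) \<le> norm (U k \<omega> / \<gamma> k)"
    proof (rule AE_I2)
      fix \<omega> assume \<omega>: "\<omega> \<in> space M"
      have "\<gamma> k * gp k \<omega> \<le> (\<Sum>j\<le>k. \<gamma> j * gp j \<omega>)"
        using gp_nonneg \<gamma>_pos by (intro member_le_sum) (auto simp: less_imp_le)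
      with telescoped[OF \<omega>, of k] have "gp k \<omega> \<le> U k \<omega> / \<gamma> k"
        using \<gamma>_pos[of k] by (simp add: field_simps)
      then show "norm (gp k \<omega>) \<le> norm (U k \<omega> / \<gamma> k)" using gp_nonneg[of k \<omega>] unfolding real_norm_def by linarith
    qed
  qed simp
  obtain S :: real where S: "S \<ge> 0" "\<And>K. (\<Sum>k\<le>K. ((real k + 1) powr (- 2 / 3))\<^sup>2) \<le> S"
    using stepsize_square_sums_bounded by blast
  define c where "c = 3 * (2 * \<sigma>\<^sup>2 + 32 * L\<^sup>2 * (2 * D)\<^sup>2) / (2 * \<mu>) + 8 * L * D\<^sup>2"
  define C where "C = \<bar>F0 - Fl\<bar> + c * S"
  have c: "c \<ge> 0" using mu_pos L by (simp add: c_def)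
  have C: "C \<ge> 0" using c S by (simp add: C_def)
  have U_le: "expectation (U K) \<le> C" for K
  proof -
    have "expectation (U K) = (F0 - Fl) + (\<Sum>k\<le>K. \<gamma> k * (expectation (err k) / (2 * \<mu>)) + 8 * L * D\<^sup>2 * (\<gamma> k)\<^sup>2)"
      unfolding U_def using err_int by (simp add: prob_space)
    also have "(\<Sum>k\<le>K. \<gamma> k * (expectation (err k) / (2 * \<mu>)) + 8 * L * D\<^sup>2 * (\<gamma> k)\<^sup>2) \<le> (\<Sum>k\<le>K. c * (\<gamma> k)\<^sup>2)"
    proof (rule sum_mono)
      fix k
      have "expectation (err k) / (2 * \<mu>) \<le> 3 * (2 * \<sigma>\<^sup>2 + 32 * L\<^sup>2 * (2 * D)\<^sup>2) * \<gamma> k / (2 * \<mu>)"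
        using error_expectation[of k] mu_pos by (intro divide_right_mono) (auto simp: err_def[abs_def])
      then have "\<gamma> k * (expectation (err k) / (2 * \<mu>)) \<le> \<gamma> k * (3 * (2 * \<sigma>\<^sup>2 + 32 * L\<^sup>2 * (2 * D)\<^sup>2) * \<gamma> k / (2 * \<mu>))"
        using \<gamma>_pos[of k] by (intro mult_left_mono) auto
      then show "\<gamma> k * (expectation (err k) / (2 * \<mu>)) + 8 * L * D\<^sup>2 * (\<gamma> k)\<^sup>2 \<le> c * (\<gamma> k)\<^sup>2"
        by (simp add: c_def power2_eq_square algebra_simps)
    qed
    also have "\<dots> \<le> c * S"
      using S(2)[of K] c by (simp add: sum_distrib_left[symmetric] \<gamma>_def mult_left_mono)
    finally show ?thesis by (simp add: C_def)
  qed
  have bound: "1 / (real K + 1) * (\<Sum>k\<le>K. expectation (gp k))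
      \<le> C * (1 + ln (real K + 1)) powr 0 * (real K + 1) powr (- 1 / 3)" for K :: nat
  proof -
    \<comment> \<open>The gaps are nonnegative and the step sizes decrease, so \<open>\<gamma> K\<close> is the smallest weight.\<close>
    have "\<gamma> K * (\<Sum>k\<le>K. expectation (gp k)) \<le> (\<Sum>k\<le>K. \<gamma> k * expectation (gp k))"
      unfolding sum_distrib_left using gp_nonneg
      by (intro sum_mono mult_right_mono) (auto simp: \<gamma>_def intro!: powr_mono2')
    also have "\<dots> = expectation (\<lambda>\<omega>. \<Sum>k\<le>K. \<gamma> k * gp k \<omega>)"
      using gp_int by (simp add: Bochner_Integration.integral_sum)
    also have "\<dots> \<le> expectation (U K)"
      using gp_int U_int telescoped by (intro integral_mono) auto
    also have "\<dots> \<le> C" by (rule U_le)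
    finally have main: "\<gamma> K * (\<Sum>k\<le>K. expectation (gp k)) \<le> C" .
    let ?n = "real K + 1"
    have "1 / ?n = ?n powr (- 1 / 3) * \<gamma> K"
      by (simp add: \<gamma>_def powr_add[symmetric] powr_minus_divide)
    then have "1 / ?n * (\<Sum>k\<le>K. expectation (gp k)) = ?n powr (- 1 / 3) * (\<gamma> K * (\<Sum>k\<le>K. expectation (gp k)))"
      by simp
    also have "\<dots> \<le> ?n powr (- 1 / 3) * C" using main by (intro mult_left_mono) auto
    also have "\<dots> = C * (1 + ln ?n) powr 0 * ?n powr (- 1 / 3)"
    proof -
      have "ln ?n \<ge> 0" by simp
      then have "1 + ln ?n \<noteq> 0" by linarith
      then show ?thesis by simp
    qed
    finally show ?thesis .
  qed
  show ?thesis
    unfolding h_eq using gp_int bound C unfolding gp_def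
    by (intro conjI allI exI[of _ C] exI[of _ 0]) auto
qed

end
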